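(* Let $n\ge 1$, let $u,v$ be $n\times 1$ vectors over $Z_4$, and let $D$ be the $2^{(2n+4)-4}$ QC design determined by $u$ and $v$, with $\lambda_1,\ldots,\lambda_{10}$, $l_1,\ldots,l_{10}$, $\rho_1,\rho_2,\xi_1,\xi_2,\xi$ as defined in the context. Then the set of all words of $D$ is the disjoint union of the following four classes. (a) A class of $4/\rho_1^2$ words, each with aliasing index $\rho_1$; half of these words have length $l_1+1$ and the rest have length $l_3+3$. (b) A class of $4/\rho_2^2$ words, each with aliasing index $\rho_2$; half of these words have length $l_2+1$ and the rest have length $l_4+3$. (c) A class of three words, each with aliasing index $1$; these have lengths $l_5+2$, $l_6+2$ and $l_7+4$. (d) In addition: (d1) if $\lambda_5+\lambda_6=0$, a class of $4/(\xi_1^2\xi_2^2)$ words, each with aliasing index $\xi_1\xi_2$ and length $l_8+2$; (d2) if $\lambda_5+\lambda_6>0$, a class of $4/\xi^2$ words, each with aliasing index $\xi$; half of these words have length $l_9+2$ and the rest have length $l_{10}+2$.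
   Context: $Z_4=\{0,1,2,3\}$ with arithmetic mod 4. Let $u=(u_1,\ldots,u_n)'$, $v=(v_1,\ldots,v_n)'$ be vectors over $Z_4$ (prime denotes transpose). The design $D$: let $C=\{(a'u,a'v,a_1,\ldots,a_n): a=(a_1,\ldots,a_n)'\in Z_4^n\}$, with $a'u,a'v$ reduced mod 4 (codewords indexed by $a\in Z_4^n$). The Gray map replaces each element of $Z_4$ by a pair: $0\to(1,1)$, $1\to(1,-1)$, $2\to(-1,-1)$, $3\to(-1,1)$. Applying it entrywise to the codewords of $C$ gives a $2^{2n}\times(2n+4)$ matrix $D$ with entries $\pm1$, called a $2^{(2n+4)-4}$ QC design; rows are runs and columns are factors. Columns are distinguished by their positions, even if they coincide as vectors. Words: let $N=2^{2n}$. For a nonempty set $S$ of $k$ columns, its aliasing index is $\frac1N\left|\sum_{s=1}^N\prod_{c\in S}c_s\right|$, where $c_s$ is the $s$th entry of column $c$. If it is nonzero, $S$ is called a word of length $k$ with that aliasing index. Notation: for $0\le k,s\le3$, $f_{ks}=\#\{j:1\le j\le n,\ u_j=k,\ v_j=s\}$. Put $\lambda_1=f_{10}+f_{30}$, $\lambda_2=f_{01}+f_{03}$, $\lambda_3=f_{12}+f_{32}$, $\lambda_4=f_{21}+f_{23}$, $\lambda_5=f_{11}+f_{33}$, $\lambda_6=f_{13}+f_{31}$, $\lambda_7=f_{02}$, $\lambda_8=f_{20}$, $\lambda_9=f_{22}$, $\lambda_{10}=f_{00}$; $l_1=2(\lambda_4+\lambda_8+\lambda_9)+\lambda_1+\lambda_3+\lambda_5+\lambda_6$,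 $l_2=2(\lambda_3+\lambda_7+\lambda_9)+\lambda_2+\lambda_4+\lambda_5+\lambda_6$, $l_3=2(\lambda_2+\lambda_8+\lambda_9)+\lambda_1+\lambda_3+\lambda_5+\lambda_6$, $l_4=2(\lambda_1+\lambda_7+\lambda_9)+\lambda_2+\lambda_4+\lambda_5+\lambda_6$, $l_5=2(\lambda_1+\lambda_3+\lambda_5+\lambda_6)$, $l_6=2(\lambda_2+\lambda_4+\lambda_5+\lambda_6)$, $l_7=2(\lambda_1+\lambda_2+\lambda_3+\lambda_4)$, $l_8=2(\lambda_7+\lambda_8)+\lambda_1+\lambda_2+\lambda_3+\lambda_4$, $l_9=2(\lambda_5+\lambda_7+\lambda_8)+\lambda_1+\lambda_2+\lambda_3+\lambda_4$, $l_{10}=2(\lambda_6+\lambda_7+\lambda_8)+\lambda_1+\lambda_2+\lambda_3+\lambda_4$; and, with $\lfloor y\rfloor$ the largest integer not exceeding $y$, $\rho_1=2^{-\lfloor(\lambda_1+\lambda_3+\lambda_5+\lambda_6)/2\rfloor}$, $\rho_2=2^{-\lfloor(\lambda_2+\lambda_4+\lambda_5+\lambda_6)/2\rfloor}$, $\xi_1=2^{-\lfloor(\lambda_1+\lambda_3)/2\rfloor}$, $\xi_2=2^{-\lfloor(\lambda_2+\lambda_4)/2\rfloor}$, $\xi=2^{-\lfloor(\lambda_1+\lambda_2+\lambda_3+\lambda_4+1)/2\rfloor}$. *)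

theory Defs
  imports Complex_Main "HOL-Library.FuncSet"
begin

(* Z_4 is represented by the residues {0..3} :: nat set, and a vector over Z_4 of length n
   by a function on {1..n}. The definitions below never look at u and v outside {1..n}. *)

definition gray :: "nat \<Rightarrow> int \<times> int" where
  "gray x = (if x = 0 then (1, 1) else if x = 1 then (1, -1)
             else if x = 2 then (-1, -1) else (-1, 1))"

definition runs :: "nat \<Rightarrow> (nat \<Rightarrow> nat) set" where
  "runs n = {1..n} \<rightarrow>\<^sub>E {0..3}"

context
  fixes n :: nat and u v :: "nat \<Rightarrow> nat"
begin

definition codeword :: "(nat \<Rightarrow> nat) \<Rightarrow> nat list" where
  "codeword a =
     [(\<Sum>j=1..n. a j * u j) mod 4, (\<Sum>j=1..n. a j * v j) mod 4] @ map a [1..<Suc n]"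

(* Entry of D in run a and column c. The columns are the positions 0, ..., 2n+3; columns 2p and
   2p+1 are the two Gray coordinates of the codeword entry at (zero-based) position p. *)
definition QC_design :: "(nat \<Rightarrow> nat) \<Rightarrow> nat \<Rightarrow> int" where
  "QC_design a c = (if even c then fst else snd) (gray (codeword a ! (c div 2)))"

definition aliasing_index :: "nat set \<Rightarrow> real" where
  "aliasing_index S = 1 / 2 ^ (2 * n) * \<bar>\<Sum>a\<in>runs n. \<Prod>c\<in>S. real_of_int (QC_design a c)\<bar>"

definition words :: "nat set set" where
  "words = {S. S \<subseteq> {0..<2 * n + 4} \<and> S \<noteq> {} \<and> aliasing_index S \<noteq> 0}"

definition freq :: "nat \<Rightarrow> nat \<Rightarrow> nat" where
  "freq k s = card {j \<in> {1..n}. u j = k \<and> v j = s}"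

definition lam\<^sub>1 :: nat where "lam\<^sub>1 = freq 1 0 + freq 3 0"
definition lam\<^sub>2 :: nat where "lam\<^sub>2 = freq 0 1 + freq 0 3"
definition lam\<^sub>3 :: nat where "lam\<^sub>3 = freq 1 2 + freq 3 2"
definition lam\<^sub>4 :: nat where "lam\<^sub>4 = freq 2 1 + freq 2 3"
definition lam\<^sub>5 :: nat where "lam\<^sub>5 = freq 1 1 + freq 3 3"
definition lam\<^sub>6 :: nat where "lam\<^sub>6 = freq 1 3 + freq 3 1"
definition lam\<^sub>7 :: nat where "lam\<^sub>7 = freq 0 2"
definition lam\<^sub>8 :: nat where "lam\<^sub>8 = freq 2 0"
definition lam\<^sub>9 :: nat where "lam\<^sub>9 = freq 2 2"

definition l\<^sub>1 :: nat where "l\<^sub>1 = 2 * (lam\<^sub>4 + lam\<^sub>8 + lam\<^sub>9) + lam\<^sub>1 + lam\<^sub>3 + lam\<^sub>5 + lam\<^sub>6"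
definition l\<^sub>2 :: nat where "l\<^sub>2 = 2 * (lam\<^sub>3 + lam\<^sub>7 + lam\<^sub>9) + lam\<^sub>2 + lam\<^sub>4 + lam\<^sub>5 + lam\<^sub>6"
definition l\<^sub>3 :: nat where "l\<^sub>3 = 2 * (lam\<^sub>2 + lam\<^sub>8 + lam\<^sub>9) + lam\<^sub>1 + lam\<^sub>3 + lam\<^sub>5 + lam\<^sub>6"
definition l\<^sub>4 :: nat where "l\<^sub>4 = 2 * (lam\<^sub>1 + lam\<^sub>7 + lam\<^sub>9) + lam\<^sub>2 + lam\<^sub>4 + lam\<^sub>5 + lam\<^sub>6"
definition l\<^sub>5 :: nat where "l\<^sub>5 = 2 * (lam\<^sub>1 + lam\<^sub>3 + lam\<^sub>5 + lam\<^sub>6)"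
definition l\<^sub>6 :: nat where "l\<^sub>6 = 2 * (lam\<^sub>2 + lam\<^sub>4 + lam\<^sub>5 + lam\<^sub>6)"
definition l\<^sub>7 :: nat where "l\<^sub>7 = 2 * (lam\<^sub>1 + lam\<^sub>2 + lam\<^sub>3 + lam\<^sub>4)"
definition l\<^sub>8 :: nat where "l\<^sub>8 = 2 * (lam\<^sub>7 + lam\<^sub>8) + lam\<^sub>1 + lam\<^sub>2 + lam\<^sub>3 + lam\<^sub>4"
definition l\<^sub>9 :: nat where "l\<^sub>9 = 2 * (lam\<^sub>5 + lam\<^sub>7 + lam\<^sub>8) + lam\<^sub>1 + lam\<^sub>2 + lam\<^sub>3 + lam\<^sub>4"
definition l\<^sub>1\<^sub>0 :: nat where "l\<^sub>1\<^sub>0 = 2 * (lam\<^sub>6 + lam\<^sub>7 + lam\<^sub>8) + lam\<^sub>1 + lam\<^sub>2 + lam\<^sub>3 + lam\<^sub>4"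

definition \<rho>\<^sub>1 :: real where
  "\<rho>\<^sub>1 = 2 powi (- \<lfloor>real (lam\<^sub>1 + lam\<^sub>3 + lam\<^sub>5 + lam\<^sub>6) / 2\<rfloor>)"
definition \<rho>\<^sub>2 :: real where
  "\<rho>\<^sub>2 = 2 powi (- \<lfloor>real (lam\<^sub>2 + lam\<^sub>4 + lam\<^sub>5 + lam\<^sub>6) / 2\<rfloor>)"
definition \<xi>\<^sub>1 :: real where
  "\<xi>\<^sub>1 = 2 powi (- \<lfloor>real (lam\<^sub>1 + lam\<^sub>3) / 2\<rfloor>)"
definition \<xi>\<^sub>2 :: real where
  "\<xi>\<^sub>2 = 2 powi (- \<lfloor>real (lam\<^sub>2 + lam\<^sub>4) / 2\<rfloor>)"
definition \<xi> :: real where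
  "\<xi> = 2 powi (- \<lfloor>real (lam\<^sub>1 + lam\<^sub>2 + lam\<^sub>3 + lam\<^sub>4 + 1) / 2\<rfloor>)"

end

(* "Half of the members of W have length p and the rest have length q", as a splitting of W into
   two parts of equal size; counting the members of length p would be wrong when p = q.
   Used only for finite W. *)
definition half_of_each_length :: "nat set set \<Rightarrow> nat \<Rightarrow> nat \<Rightarrow> bool" where
  "half_of_each_length W p q \<longleftrightarrow>
     (\<exists>P Q. W = P \<union> Q \<and> P \<inter> Q = {} \<and> card P = card Q \<and>
            (\<forall>S\<in>P. card S = p) \<and> (\<forall>S\<in>Q. card S = q))"

end

(* Each Gray coordinate is a function on Z_4 with a two-term Fourier expansion over the faithful
   characters, and the product of both is the character of order 2. Summing over the runs therefore leaves, for every set S of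
   columns, a sum over the sixteen words w = (s, t, -(s u_j + t v_j)_j) of the code dual to C:
   the contribution of w vanishes unless S contains exactly one Gray column at each position with
   w_p odd, both at each position with w_p = 2 and none where w_p = 0, and then it is a product
   of factors (1 - i)/2 and (1 + i)/2, one per odd position, according to the choices made by S.
   Since w and -w contribute complex conjugates, a pair {w, -w} with m > 0 odd positions gives
   twice a real part, which is 0 or +-2^(-q) with q = (m - 1) div 2 and is nonzero for exactly
   2^(2q+1) choices. The pairs (1,0), (1,2) give class (a), (0,1), (2,1) give (b), the three
   words of order 2 give (c), and (1,1), (1,3) give (d). The last two pairs have the same odd
   positions exactly when no u_j, v_j are both odd; then the four terms factor into a product of
   two real parts. *)
theory Submission
  imports Defs
begin

section \<open>Products of Gray coefficients\<close>

text \<open>Since (1 + i)/2 is i times (1 - i)/2, only the number of factors and the number of those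
  of the second kind matter.\<close>

lemma prod_gray_coeffs:
  assumes "finite X"
  shows "(\<Prod>p\<in>X. if p \<in> Y \<longleftrightarrow> p \<in> B then (1 - \<i>) / 2 else (1 + \<i>) / 2)
    = ((1 - \<i>) / 2) ^ card X * \<i> ^ card {p \<in> X. p \<in> Y \<longleftrightarrow> p \<notin> B}"
proof -
  have "(1 + \<i>) / 2 = (1 - \<i>) / 2 * \<i>"
    by (simp add: field_simps)
  then have "(\<Prod>p\<in>X. if p \<in> Y \<longleftrightarrow> p \<in> B then (1 - \<i>) / 2 else (1 + \<i>) / 2)
    = (\<Prod>p\<in>X. (1 - \<i>) / 2 * (if p \<in> Y \<longleftrightarrow> p \<notin> B then \<i> else 1))"
    by (intro prod.cong refl) auto
  also have "\<dots> = ((1 - \<i>) / 2) ^ card X * \<i> ^ card {p \<in> X. p \<in> Y \<longleftrightarrow> p \<notin> B}"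
    using assms by (simp only: prod.distrib) (simp add: prod.If_cases Int_def)
  finally show ?thesis .
qed

lemma imaginary_unit_power_cases: "\<i> ^ m \<in> {1, \<i>, -1, -\<i>}"
  by (induction m) auto

lemma imaginary_unit_power_even_cases: "even m \<Longrightarrow> \<i> ^ m \<in> {1, -1}"
  by (auto elim!: evenE simp: power_mult) (metis neg_one_even_power neg_one_odd_power)

lemma imaginary_unit_power_odd_cases: "odd m \<Longrightarrow> \<i> ^ m \<in> {\<i>, -\<i>}"
  using imaginary_unit_power_even_cases[of "m - 1"]
  by (auto elim!: oddE simp: power_mult)

lemma Re_of_real_mult: "Re (of_real x * z) = x * Re z"
  by simp

text \<open>Pulling out squares reduces a power of (1 - i)/2, up to a real scalar, to a power of i,
  with one factor 1 - i left over for odd exponents.\<close>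

lemma gray_square: "((1 - \<i>) / 2)\<^sup>2 = of_real (- 1 / 2) * \<i>"
  by (simp add: power2_eq_square field_simps)

text \<open>Without the squares, (1 - i) i^k remains, whose real part is 1 or -1 for every k; hence
  odd exponents never give 0.\<close>

lemma abs_Re_gray_power_odd:
  "\<bar>2 * Re (((1 - \<i>) / 2) ^ (2 * q + 1) * \<i> ^ r)\<bar> = (1 / 2) ^ q"
proof -
  define c :: real where "c = - 1 / 2"
  have "((1 - \<i>) / 2) ^ (2 * q + 1) * \<i> ^ r = of_real (c ^ q / 2) * ((1 - \<i>) * \<i> ^ (q + r))"
    unfolding power_add power_mult gray_square c_def[symmetric]
    by (simp add: power_mult_distrib)
  then have "2 * Re (((1 - \<i>) / 2) ^ (2 * q + 1) * \<i> ^ r) = c ^ q * Re ((1 - \<i>) * \<i> ^ (q + r))"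
    by (simp only: Re_of_real_mult)
  moreover have "\<bar>Re ((1 - \<i>) * \<i> ^ (q + r))\<bar> = 1"
    using imaginary_unit_power_cases[of "q + r"] by (auto simp del: power_add)
  ultimately show ?thesis
    by (simp only: abs_mult power_abs) (simp add: c_def)
qed

text \<open>Here a bare power of i remains, whose real part vanishes for odd exponents. The factor 2
  turns (1/2)^(q + 1) into (1/2)^q.\<close>

lemma abs_Re_gray_power_even:
  "\<bar>2 * Re (((1 - \<i>) / 2) ^ (2 * q + 2) * \<i> ^ r)\<bar> = (if even (q + 1 + r) then (1 / 2) ^ q else 0)"
proof -
  define c :: real where "c = - 1 / 2"
  have "((1 - \<i>) / 2) ^ (2 * (q + 1)) * \<i> ^ r = of_real (c ^ (q + 1)) * (\<i> ^ (q + 1 + r))"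
    unfolding power_mult gray_square c_def[symmetric]
    by (simp add: power_mult_distrib power_add)
  then have "2 * Re (((1 - \<i>) / 2) ^ (2 * q + 2) * \<i> ^ r) = 2 * (c ^ (q + 1) * Re (\<i> ^ (q + 1 + r)))"
    by (metis Re_of_real_mult distrib_left_numeral mult_2_right numeral_Bit0 numeral_One mult.right_neutral)
  moreover have "\<bar>Re (\<i> ^ (q + 1 + r))\<bar> = (if even (q + 1 + r) then 1 else 0)"
    using imaginary_unit_power_even_cases[of "q + 1 + r"] imaginary_unit_power_odd_cases[of "q + 1 + r"]
    by (auto simp del: power_Suc power_add)
  ultimately show ?thesis
    by (simp only: abs_mult power_abs) (simp add: c_def)
qed

text \<open>In the application \<open>X\<close> is the set of odd positions of a dual word,
  \<open>Y\<close> marks those where the second Gray column is chosen, and \<open>B\<close> marks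
  the letters 3.\<close>

definition signed_prod :: "'a set \<Rightarrow> 'a set \<Rightarrow> 'a set \<Rightarrow> complex" where
  "signed_prod B X Y = (\<Prod>p\<in>X. if p \<in> Y \<longleftrightarrow> p \<in> B then (1 - \<i>) / 2 else (1 + \<i>) / 2)"

text \<open>\<open>card X\<close> is 2q + 1 or 2q + 2, so both parities share one nonzero absolute
  value; only the second can yield 0.\<close>

lemma abs_Re_signed_prod:
  assumes "finite X" "X \<noteq> {}"
  defines "q \<equiv> (card X - 1) div 2"
  shows "\<bar>2 * Re (signed_prod B X Y)\<bar> =
    (if odd (card X) \<or> even (q + 1 + card {p \<in> X. p \<in> Y \<longleftrightarrow> p \<notin> B}) then (1 / 2) ^ q else 0)"
proof (cases "odd (card X)")
  case True
  then have "card X = 2 * q + 1"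
    unfolding q_def by (auto elim!: oddE)
  with True show ?thesis
    using assms(1) abs_Re_gray_power_odd
    by (simp only: signed_prod_def prod_gray_coeffs) simp
next
  case False
  moreover have "card X > 0"
    using assms by (simp add: card_gt_0_iff)
  ultimately have "card X = 2 * q + 2"
    unfolding q_def by (auto elim!: evenE)
  with False show ?thesis
    using assms(1) abs_Re_gray_power_even
    by (simp only: signed_prod_def prod_gray_coeffs) simp
qed

section \<open>Counting the choices with nonzero real part\<close>

lemma card_subsets_parity:
  assumes "finite X" "X \<noteq> {}"
  shows "card {Y. Y \<subseteq> X \<and> even (r + card Y)} = 2 ^ (card X - 1)"
proof -
  let ?E = "{Y. Y \<subseteq> X \<and> even (card Y)}" and ?O = "{Y. Y \<subseteq> X \<and> odd (card Y)}"
  have "card ?E = card ?O"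
    using card_subsupersets_even_odd[of X "{}"] assms by auto
  moreover have "card ?E + card ?O = card (Pow X)"
    using assms by (subst card_Un_disjoint[symmetric]) (auto intro!: arg_cong[where f = card])
  moreover have "card (Pow X) = 2 * 2 ^ (card X - 1)"
    using assms by (simp add: card_Pow power_eq_if)
  ultimately show ?thesis
    by (cases "even r") simp_all
qed

text \<open>On the subsets of \<open>X\<close>, symmetric difference with the part of
  \<open>B\<close> inside \<open>X\<close> is an involution, so the count for plain subsets carries
  over.\<close>

lemma card_subsets_parity_shifted:
  assumes "finite X" "X \<noteq> {}"
  shows "card {Y. Y \<subseteq> X \<and> even (r + card {p \<in> X. p \<in> Y \<longleftrightarrow> p \<notin> B})} = 2 ^ (card X - 1)"
proof -
  let ?f = "\<lambda>Y. {p \<in> X. p \<in> Y \<longleftrightarrow> p \<notin> B}"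
  have "bij_betw ?f {Y. Y \<subseteq> X \<and> even (r + card (?f Y))} {Y. Y \<subseteq> X \<and> even (r + card Y)}"
  proof (rule bij_betwI[where g = ?f])
    have "?f (?f Y) = Y" if "Y \<subseteq> X" for Y
      using that by auto
    then show "?f \<in> {Y. Y \<subseteq> X \<and> even (r + card Y)} \<rightarrow> {Y. Y \<subseteq> X \<and> even (r + card (?f Y))}"
      by auto
  qed auto
  then show ?thesis
    using card_subsets_parity[OF assms] by (simp add: bij_betw_same_card)
qed

text \<open>For \<open>card X\<close> equal to 2q + 1 all subsets count, for 2q + 2 half of them;
  both times this gives 2^(2q + 1).\<close>

lemma card_signed_prod_nonzero:
  assumes "finite X" "X \<noteq> {}"
  shows "card {Y. Y \<subseteq> X \<and> Re (signed_prod B X Y) \<noteq> 0} = 2 ^ (2 * ((card X - 1) div 2) + 1)"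
proof -
  define q where "q = (card X - 1) div 2"
  have "Re (signed_prod B X Y) \<noteq> 0 \<longleftrightarrow>
      odd (card X) \<or> even (q + 1 + card {p \<in> X. p \<in> Y \<longleftrightarrow> p \<notin> B})" for Y
    using abs_Re_signed_prod[OF assms, of B Y] by (auto simp: q_def split: if_splits)
  note nz = this
  show ?thesis
  proof (cases "odd (card X)")
    case True
    then have "{Y. Y \<subseteq> X \<and> Re (signed_prod B X Y) \<noteq> 0} = Pow X"
      using nz by auto
    moreover have "card X = 2 * q + 1"
      using True unfolding q_def by (auto elim!: oddE)
    ultimately show ?thesis
      using assms by (simp add: card_Pow flip: q_def)
  next
    case False
    moreover have "card X > 0"
      using assms by (simp add: card_gt_0_iff)
    ultimately have "card X = 2 * q + 2"
      unfolding q_def by (auto elim!: evenE)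
    then show ?thesis
      using card_subsets_parity_shifted[OF assms, of "q + 1" B] nz False
      by (simp flip: q_def)
  qed
qed

text \<open>Used when two disjoint sets of odd positions impose independent conditions, as in class
  (d1).\<close>

lemma card_subsets_disjoint_union:
  assumes "X \<inter> X' = {}"
  shows "card {Y. Y \<subseteq> X \<union> X' \<and> P (Y \<inter> X) \<and> Q (Y \<inter> X')} =
    card {Y. Y \<subseteq> X \<and> P Y} * card {Y. Y \<subseteq> X' \<and> Q Y}"
proof -
  have "bij_betw (\<lambda>Y. (Y \<inter> X, Y \<inter> X')) {Y. Y \<subseteq> X \<union> X' \<and> P (Y \<inter> X) \<and> Q (Y \<inter> X')}
     ({Y. Y \<subseteq> X \<and> P Y} \<times> {Y. Y \<subseteq> X' \<and> Q Y})"
  proof (rule bij_betwI[where g = "\<lambda>(Y, Y'). Y \<union> Y'"])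
    have "(Y \<union> Y') \<inter> X = Y" "(Y \<union> Y') \<inter> X' = Y'" if "Y \<subseteq> X" "Y' \<subseteq> X'" for Y Y'
      using that assms by auto
    then show "(\<lambda>(Y, Y'). Y \<union> Y') \<in> {Y. Y \<subseteq> X \<and> P Y} \<times> {Y. Y \<subseteq> X' \<and> Q Y} \<rightarrow>
        {Y. Y \<subseteq> X \<union> X' \<and> P (Y \<inter> X) \<and> Q (Y \<inter> X')}"
      by auto
  qed (use assms in auto)
  then show ?thesis
    by (simp add: bij_betw_same_card card_cartesian_product)
qed

section \<open>Fourier expansion of the aliasing index\<close>

text \<open>The coefficient of \<open>\<i> ^ (k * a)\<close> in the product of those of the two Gray coordinates of \<open>a\<close>
  that are selected by \<open>x\<close> and \<open>y\<close>.\<close>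

definition gray_coeff :: "bool \<Rightarrow> bool \<Rightarrow> nat \<Rightarrow> complex" where
  "gray_coeff x y k =
    (if x \<noteq> y then if even k then 0 else if x \<longleftrightarrow> k = 1 then (1 - \<i>) / 2 else (1 + \<i>) / 2
     else of_bool (k = (if x then 2 else 0)))"

definition gray_factor :: "bool \<Rightarrow> bool \<Rightarrow> nat \<Rightarrow> complex" where
  "gray_factor x y a = of_int ((if x then fst (gray a) else 1) * (if y then snd (gray a) else 1))"

lemma less_4_cases: "(a::nat) < 4 \<Longrightarrow> a = 0 \<or> a = 1 \<or> a = 2 \<or> a = 3"
  by auto

lemma lessThan_4: "{..<4::nat} = {0, 1, 2, 3}"
  by auto

lemma imaginary_unit_cube: "\<i> ^ 3 = - \<i>"
  by (simp add: power3_eq_cube)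

lemma imaginary_unit_power_mod_4: "\<i> ^ (k mod 4) = \<i> ^ k"
proof -
  have "\<i> ^ k = (\<i> ^ 4) ^ (k div 4) * \<i> ^ (k mod 4)"
    by (metis power_add power_mult mult_div_mod_eq)
  then show ?thesis
    by (simp add: power4_eq_xxxx)
qed

text \<open>The functions i^(k a) of a are the characters of Z_4. Reducing their exponents modulo 4
  makes the expansion a finite check.\<close>

lemma gray_factor_expansion:
  assumes "a < 4"
  shows "gray_factor x y a = (\<Sum>k<4. gray_coeff x y k * \<i> ^ (k * a))"
proof -
  have "gray_factor x y a = (\<Sum>k<4. gray_coeff x y k * \<i> ^ (k * a mod 4))"
    using less_4_cases[OF assms]
    by (cases x; cases y) (auto simp: gray_factor_def gray_coeff_def gray_def lessThan_4
        imaginary_unit_cube field_simps)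
  then show ?thesis
    by (simp only: imaginary_unit_power_mod_4)
qed

text \<open>The inverse transform: by orthogonality, summing against the character of index
  \<open>m\<close> isolates the coefficient at -m, up to the group order 4.\<close>

lemma gray_factor_transform:
  "(\<Sum>a<4. \<i> ^ (m * a) * gray_factor x y a) = 4 * gray_coeff x y (3 * m mod 4)"
proof -
  define r where "r = m mod 4"
  have "r < 4"
    by (simp add: r_def)
  then have "(\<Sum>a<4. \<i> ^ (r * a mod 4) * gray_factor x y a) = 4 * gray_coeff x y (3 * r mod 4)"
    using less_4_cases[OF \<open>r < 4\<close>]
    by (cases x; cases y) (auto simp: gray_factor_def gray_coeff_def gray_def lessThan_4
        imaginary_unit_cube field_simps)
  then show ?thesis
    unfolding r_def mod_mult_left_eq mod_mult_right_eq imaginary_unit_power_mod_4 .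
qed

text \<open>Writing \<open>3 * x\<close> for \<open>- x\<close> modulo 4 keeps everything in \<open>nat\<close>.\<close>

definition dual_word :: "(nat \<Rightarrow> nat) \<Rightarrow> (nat \<Rightarrow> nat) \<Rightarrow> nat \<Rightarrow> nat \<Rightarrow> nat \<Rightarrow> nat" where
  "dual_word u v s t p =
    (if p = 0 then s else if p = 1 then t else 3 * (s * u (p - 1) + t * v (p - 1)) mod 4)"

definition coeff_prod :: "nat \<Rightarrow> (nat \<Rightarrow> nat) \<Rightarrow> nat set \<Rightarrow> complex" where
  "coeff_prod N w S = (\<Prod>p<N. gray_coeff (2 * p \<in> S) (2 * p + 1 \<in> S) (w p))"

lemma prod_lessThan_double:
  "(\<Prod>c<2 * N. f c) = (\<Prod>p<N. f (2 * p) * f (2 * p + 1))"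
  for f :: "nat \<Rightarrow> 'a::comm_monoid_mult"
  by (induction N) (auto simp: algebra_simps)

text \<open>Positions 0 and 1 carry the two linear forms in the run; position j + 1 carries its j-th
  entry.\<close>

lemma prod_positions:
  "(\<Prod>p<n + 2. f p) = f 0 * f 1 * (\<Prod>j=1..n. f (j + 1))"
  for f :: "nat \<Rightarrow> 'a::comm_monoid_mult"
  by (simp add: prod.lessThan_Suc_shift prod.atLeast1_atMost_eq algebra_simps del: prod.lessThan_Suc)

lemma codeword_nth:
  "codeword n u v a ! 0 = (\<Sum>j=1..n. a j * u j) mod 4"
  "codeword n u v a ! 1 = (\<Sum>j=1..n. a j * v j) mod 4"
  "j \<in> {1..n} \<Longrightarrow> codeword n u v a ! (j + 1) = a j"
  by (auto simp: codeword_def nth_append nth_Cons' simp del: upt_Suc)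

text \<open>Factors 1 for the columns outside \<open>S\<close> allow all columns to be grouped by
  codeword position.\<close>

lemma prod_QC_design:
  assumes "S \<subseteq> {0..<2 * n + 4}"
  shows "of_int (\<Prod>c\<in>S. QC_design n u v a c) =
    (\<Prod>p<n + 2. gray_factor (2 * p \<in> S) (2 * p + 1 \<in> S) (codeword n u v a ! p))"
proof -
  have "(\<Prod>c\<in>S. QC_design n u v a c) = (\<Prod>c<2 * (n + 2). if c \<in> S then QC_design n u v a c else 1)"
    using assms by (subst prod.inter_filter[symmetric]) (auto intro!: prod.cong)
  also have "of_int \<dots> = (\<Prod>p<n + 2. gray_factor (2 * p \<in> S) (2 * p + 1 \<in> S) (codeword n u v a ! p))"
    unfolding prod_lessThan_double of_int_prod
    by (intro prod.cong refl) (auto simp: gray_factor_def QC_design_def)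
  finally show ?thesis .
qed

text \<open>Poisson summation over the code leaves only the sixteen words of the dual code.\<close>

lemma sum_prod_QC_design:
  assumes "S \<subseteq> {0..<2 * n + 4}"
  shows "(\<Sum>a\<in>runs n. of_int (\<Prod>c\<in>S. QC_design n u v a c)) =
    4 ^ n * (\<Sum>s<4. \<Sum>t<4. coeff_prod (n + 2) (dual_word u v s t) S)"
proof -
  define x y where "x p \<longleftrightarrow> 2 * p \<in> S" and "y p \<longleftrightarrow> 2 * p + 1 \<in> S" for p
  define h where "h p = gray_factor (x p) (y p)" for p
  define c where "c p = gray_coeff (x p) (y p)" for p
  \<comment> \<open>Only the two linear forms are expanded in characters. These split over the
    coordinates of the run, while the other entries stay as factors.\<close>
  have expand: "(\<Prod>p<n + 2. h p (codeword n u v a ! p)) =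
      (\<Sum>s<4. \<Sum>t<4. c 0 s * c 1 t * (\<Prod>j=1..n. \<i> ^ ((s * u j + t * v j) * a j) * h (j + 1) (a j)))" for a
  proof -
    have split: "(\<Prod>j=1..n. \<i> ^ ((s * u j + t * v j) * a j)) =
        \<i> ^ (s * (\<Sum>j=1..n. a j * u j)) * \<i> ^ (t * (\<Sum>j=1..n. a j * v j))" for s t
      by (simp add: power_sum sum_distrib_left prod.distrib power_add algebra_simps)
    have h0: "h p (m mod 4) = (\<Sum>k<4. c p k * \<i> ^ (k * m))" for p m
      unfolding h_def c_def
      by (subst gray_factor_expansion, simp)
        (metis (no_types, lifting) imaginary_unit_power_mod_4 mod_mult_right_eq)
    have "(\<Prod>p<n + 2. h p (codeword n u v a ! p)) =
      h 0 ((\<Sum>j=1..n. a j * u j) mod 4) * h 1 ((\<Sum>j=1..n. a j * v j) mod 4) * (\<Prod>j=1..n. h (j + 1) (a j))"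
      unfolding prod_positions codeword_nth
      by (intro arg_cong2[where f = "(*)"] prod.cong refl) (simp only: codeword_nth)
    also have "\<dots> = (\<Sum>s<4. \<Sum>t<4. c 0 s * c 1 t * (\<Prod>j=1..n. \<i> ^ ((s * u j + t * v j) * a j) * h (j + 1) (a j)))"
      unfolding h0 prod.distrib split sum_product unfolding sum_distrib_right
      by (intro sum.cong refl) (simp add: algebra_simps)
    finally show ?thesis .
  qed
  \<comment> \<open>For fixed \<open>s\<close> and \<open>t\<close> the summand is a product over
    coordinates, so the sum over the runs is a product of one-variable transforms, evaluated at the
    letters of the dual word.\<close>
  have trans: "(\<Sum>a\<in>runs n. \<Prod>j=1..n. \<i> ^ ((s * u j + t * v j) * a j) * h (j + 1) (a j)) =
      4 ^ n * (\<Prod>j=1..n. c (j + 1) (3 * (s * u j + t * v j) mod 4))" for s t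
  proof -
    have "(\<Sum>a\<in>runs n. \<Prod>j=1..n. \<i> ^ ((s * u j + t * v j) * a j) * h (j + 1) (a j)) =
        (\<Prod>j=1..n. \<Sum>b\<in>{0..3}. \<i> ^ ((s * u j + t * v j) * b) * h (j + 1) b)"
      unfolding runs_def by (subst prod_sum_PiE) auto
    also have "{0..3::nat} = {..<4}"
      by auto
    also have "(\<Prod>j=1..n. \<Sum>b<4. \<i> ^ ((s * u j + t * v j) * b) * h (j + 1) b) =
        (\<Prod>j=1..n. 4 * c (j + 1) (3 * (s * u j + t * v j) mod 4))"
      unfolding h_def c_def gray_factor_transform ..
    finally show ?thesis
      by (simp add: prod.distrib)
  qed
  have "(\<Sum>a\<in>runs n. of_int (\<Prod>c\<in>S. QC_design n u v a c)) =
      (\<Sum>a\<in>runs n. \<Prod>p<n + 2. h p (codeword n u v a ! p))"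
    using prod_QC_design[OF assms] by (simp add: h_def x_def y_def)
  also have "\<dots> = (\<Sum>s<4. \<Sum>t<4. c 0 s * c 1 t *
      (\<Sum>a\<in>runs n. \<Prod>j=1..n. \<i> ^ ((s * u j + t * v j) * a j) * h (j + 1) (a j)))"
    unfolding expand
    by (subst sum.swap, intro sum.cong refl, subst sum.swap) (simp add: sum_distrib_left)
  also have "\<dots> = (\<Sum>s<4. \<Sum>t<4. 4 ^ n * coeff_prod (n + 2) (dual_word u v s t) S)"
    unfolding trans coeff_prod_def prod_positions
    by (intro sum.cong refl) (simp add: c_def x_def y_def dual_word_def algebra_simps)
  finally show ?thesis
    by (simp add: sum_distrib_left)
qed

text \<open>The normalisation 2^(-2n) cancels the factor 4^n; the real sum is read as a complex
  number to turn its absolute value into \<open>cmod\<close>.\<close>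

lemma aliasing_index_eq:
  assumes "S \<subseteq> {0..<2 * n + 4}"
  shows "aliasing_index n u v S = cmod (\<Sum>s<4. \<Sum>t<4. coeff_prod (n + 2) (dual_word u v s t) S)"
proof -
  have "(\<Sum>a\<in>runs n. of_int (\<Prod>c\<in>S. QC_design n u v a c)) =
      complex_of_real (\<Sum>a\<in>runs n. \<Prod>c\<in>S. real_of_int (QC_design n u v a c))"
    by simp
  then have "\<bar>\<Sum>a\<in>runs n. \<Prod>c\<in>S. real_of_int (QC_design n u v a c)\<bar> =
      cmod (\<Sum>a\<in>runs n. of_int (\<Prod>c\<in>S. QC_design n u v a c))"
    by (simp only: norm_of_real)
  also have "\<dots> = 2 ^ (2 * n) * cmod (\<Sum>s<4. \<Sum>t<4. coeff_prod (n + 2) (dual_word u v s t) S)"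
    unfolding sum_prod_QC_design[OF assms] by (simp add: norm_mult norm_power power_mult)
  finally show ?thesis
    by (simp add: aliasing_index_def)
qed

section \<open>Sets of columns fitting a dual word\<close>

definition odd_positions :: "nat \<Rightarrow> (nat \<Rightarrow> nat) \<Rightarrow> nat set" where
  "odd_positions N w = {p. p < N \<and> odd (w p)}"

text \<open>For letters below 4 these are the column sets at which no factor of
  \<open>coeff_prod\<close> vanishes. At a letter 0 both right-hand sides are false, which leaves
  neither column.\<close>

definition fitting :: "nat \<Rightarrow> (nat \<Rightarrow> nat) \<Rightarrow> nat set set" where
  "fitting N w = {S. S \<subseteq> {0..<2 * N} \<and>
    (\<forall>p<N. (2 * p \<in> S \<and> 2 * p + 1 \<in> S \<longleftrightarrow> w p = 2) \<and> ((2 * p \<in> S) \<noteq> (2 * p + 1 \<in> S) \<longleftrightarrow> odd (w p)))}"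

definition fitting_set :: "nat \<Rightarrow> (nat \<Rightarrow> nat) \<Rightarrow> nat set \<Rightarrow> nat set" where
  "fitting_set N w Y =
    {c. c < 2 * N \<and> (w (c div 2) = 2 \<or> odd (w (c div 2)) \<and> (odd c \<longleftrightarrow> c div 2 \<in> Y))}"

lemma finite_odd_positions [simp]: "finite (odd_positions N w)"
  by (simp add: odd_positions_def)

lemma finite_fitting [simp]: "finite (fitting N w)"
  by (rule finite_subset[of _ "Pow {0..<2 * N}"]) (auto simp: fitting_def)

lemma fitting_set_iff:
  "2 * p \<in> fitting_set N w Y \<longleftrightarrow> p < N \<and> (w p = 2 \<or> odd (w p) \<and> p \<notin> Y)"
  "2 * p + 1 \<in> fitting_set N w Y \<longleftrightarrow> p < N \<and> (w p = 2 \<or> odd (w p) \<and> p \<in> Y)"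
  by (auto simp: fitting_set_def)

lemma set_eq_by_parity:
  fixes S T :: "nat set"
  assumes "\<And>p. 2 * p \<in> S \<longleftrightarrow> 2 * p \<in> T" "\<And>p. 2 * p + 1 \<in> S \<longleftrightarrow> 2 * p + 1 \<in> T"
  shows "S = T"
proof (rule set_eqI)
  fix c
  show "c \<in> S \<longleftrightarrow> c \<in> T"
    using assms[of "c div 2"] by (cases "even c") (auto simp: odd_two_times_div_two_succ)
qed

text \<open>A fitting set is free only in the choice between two columns at each odd position; the
  inverse map records where the second one was taken.\<close>

lemma bij_betw_fitting_set:
  "bij_betw (fitting_set N w) (Pow (odd_positions N w)) (fitting N w)"
proof (rule bij_betwI[where g = "\<lambda>S. {p \<in> odd_positions N w. 2 * p + 1 \<in> S}"])
  show "fitting_set N w \<in> Pow (odd_positions N w) \<rightarrow> fitting N w"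
    unfolding fitting_def by (auto simp: fitting_set_iff[simplified]) (auto simp: fitting_set_def)
  fix S assume "S \<in> fitting N w"
  then have S: "S \<subseteq> {0..<2 * N}"
    "\<And>p. p < N \<Longrightarrow> 2 * p \<in> S \<and> 2 * p + 1 \<in> S \<longleftrightarrow> w p = 2"
    "\<And>p. p < N \<Longrightarrow> (2 * p \<in> S) \<noteq> (2 * p + 1 \<in> S) \<longleftrightarrow> odd (w p)"
    by (auto simp: fitting_def)
  show "fitting_set N w {p \<in> odd_positions N w. 2 * p + 1 \<in> S} = S"
  proof (rule set_eq_by_parity)
    fix p
    have "p < N" if "2 * p \<in> S \<or> 2 * p + 1 \<in> S"
      using that S(1) by auto
    then show "2 * p \<in> fitting_set N w {p \<in> odd_positions N w. 2 * p + 1 \<in> S} \<longleftrightarrow> 2 * p \<in> S"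
      "2 * p + 1 \<in> fitting_set N w {p \<in> odd_positions N w. 2 * p + 1 \<in> S} \<longleftrightarrow> 2 * p + 1 \<in> S"
      using S(2,3)[of p] unfolding fitting_set_iff odd_positions_def by blast+
  qed
qed (auto simp: fitting_set_iff[simplified] odd_positions_def)

lemma card_fitting:
  assumes "S \<in> fitting N w"
  shows "card S = card (odd_positions N w) + 2 * card {p. p < N \<and> w p = 2}"
proof -
  have double: "(\<Sum>c<2 * M. f c) = (\<Sum>p<M. f (2 * p) + f (2 * p + 1))" for M and f :: "nat \<Rightarrow> nat"
    by (induction M) auto
  have S: "S \<subseteq> {0..<2 * N}"
    "\<And>p. p < N \<Longrightarrow> (2 * p \<in> S \<and> 2 * p + 1 \<in> S \<longleftrightarrow> w p = 2) \<and> ((2 * p \<in> S) \<noteq> (2 * p + 1 \<in> S) \<longleftrightarrow> odd (w p))"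
    using assms by (auto simp: fitting_def)
  have "card S = (\<Sum>c<2 * N. of_bool (c \<in> S))"
    using S(1) by (auto simp: sum.If_cases of_bool_def intro!: arg_cong[where f = card])
  also have "\<dots> = (\<Sum>p<N. of_bool (odd (w p)) + 2 * of_bool (w p = 2))"
    unfolding double
  proof (intro sum.cong refl)
    fix p assume "p \<in> {..<N}"
    then show "of_bool (2 * p \<in> S) + of_bool (2 * p + 1 \<in> S) = of_bool (odd (w p)) + 2 * (of_bool (w p = 2) :: nat)"
      using S(2)[of p] by auto
  qed
  also have "\<dots> = card (odd_positions N w) + 2 * card {p. p < N \<and> w p = 2}"
    by (simp add: sum.distrib sum_distrib_left[symmetric] odd_positions_def of_bool_def sum.If_cases Int_def)
  finally show ?thesis .
qed

lemma coeff_prod_not_fitting: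
  assumes "S \<subseteq> {0..<2 * N}" "S \<notin> fitting N w"
  shows "coeff_prod N w S = 0"
proof -
  obtain p where "p < N" and p: "\<not> ((2 * p \<in> S \<and> 2 * p + 1 \<in> S \<longleftrightarrow> w p = 2) \<and>
      ((2 * p \<in> S) \<noteq> (2 * p + 1 \<in> S) \<longleftrightarrow> odd (w p)))"
    using assms unfolding fitting_def by blast
  have "gray_coeff x y k = 0" if "\<not> ((x \<and> y \<longleftrightarrow> k = 2) \<and> (x \<noteq> y \<longleftrightarrow> odd k))" for x y k
    using that by (auto simp: gray_coeff_def)
  from this[OF p] \<open>p < N\<close> show ?thesis
    unfolding coeff_prod_def by (intro prod_zero) auto
qed

text \<open>Even letters contribute 1. Passing from letter 1 to letter 3 exchanges the coefficients
  of the two columns, hence the letters 3 in the role of \<open>B\<close>.\<close>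

lemma coeff_prod_fitting_set:
  assumes "\<And>p. p < N \<Longrightarrow> w p < 4" "Y \<subseteq> odd_positions N w"
  shows "coeff_prod N w (fitting_set N w Y) = signed_prod {p. w p = 3} (odd_positions N w) Y"
proof -
  have "coeff_prod N w (fitting_set N w Y) =
    (\<Prod>p<N. if odd (w p) then if p \<in> Y \<longleftrightarrow> w p = 3 then (1 - \<i>) / 2 else (1 + \<i>) / 2 else 1)"
    unfolding coeff_prod_def fitting_set_iff
  proof (intro prod.cong refl)
    fix p assume "p \<in> {..<N}"
    then show "gray_coeff (p < N \<and> (w p = 2 \<or> odd (w p) \<and> p \<notin> Y)) (p < N \<and> (w p = 2 \<or> odd (w p) \<and> p \<in> Y)) (w p)
      = (if odd (w p) then if p \<in> Y \<longleftrightarrow> w p = 3 then (1 - \<i>) / 2 else (1 + \<i>) / 2 else 1)"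
      using less_4_cases[OF assms(1)[of p]] by (auto simp: gray_coeff_def)
  qed
  also have "\<dots> = signed_prod {p. w p = 3} (odd_positions N w) Y"
    unfolding signed_prod_def
    by (intro prod.mono_neutral_cong_right) (auto simp: odd_positions_def)
  finally show ?thesis .
qed

text \<open>Negation exchanges the letters 1 and 3, whose coefficients are conjugate, and fixes 0
  and 2, whose coefficients are real.\<close>

lemma coeff_prod_neg:
  assumes "\<And>p. p < N \<Longrightarrow> w p < 4" "\<And>p. p < N \<Longrightarrow> w' p = 3 * w p mod 4"
  shows "coeff_prod N w' S = cnj (coeff_prod N w S)"
proof -
  have "gray_coeff x y (3 * k mod 4) = cnj (gray_coeff x y k)" if "k < 4" for x y k
    using less_4_cases[OF that] by (auto simp: gray_coeff_def)
  then show ?thesis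
    using assms by (simp add: coeff_prod_def)
qed

lemma abs_Re_coeff_prod:
  assumes "\<And>p. p < N \<Longrightarrow> w p < 4" "odd_positions N w \<noteq> {}" "S \<in> fitting N w"
    and "Re (coeff_prod N w S) \<noteq> 0"
  shows "\<bar>2 * Re (coeff_prod N w S)\<bar> = (1 / 2) ^ ((card (odd_positions N w) - 1) div 2)"
proof -
  obtain Y where "Y \<subseteq> odd_positions N w" "S = fitting_set N w Y"
    using assms(3) bij_betw_imp_surj_on[OF bij_betw_fitting_set[of N w]] by blast
  then show ?thesis
    using assms(1,2,4) abs_Re_signed_prod[of "odd_positions N w" "{p. w p = 3}" Y]
    by (auto simp: coeff_prod_fitting_set split: if_splits)
qed

lemma card_fitting_filter:
  "card {S \<in> fitting N w. P S} = card {Y. Y \<subseteq> odd_positions N w \<and> P (fitting_set N w Y)}"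
proof -
  have "fitting_set N w ` {Y. Y \<subseteq> odd_positions N w \<and> P (fitting_set N w Y)} =
      {S \<in> fitting_set N w ` Pow (odd_positions N w). P S}"
    by auto
  then have "bij_betw (fitting_set N w) {Y. Y \<subseteq> odd_positions N w \<and> P (fitting_set N w Y)}
      {S \<in> fitting N w. P S}"
    unfolding bij_betw_imp_surj_on[OF bij_betw_fitting_set]
    by (rule bij_betw_subset[OF bij_betw_fitting_set, rotated]) auto
  then show ?thesis
    by (simp add: bij_betw_same_card)
qed

lemma card_fitting_nonzero:
  assumes "\<And>p. p < N \<Longrightarrow> w p < 4" "odd_positions N w \<noteq> {}"
  shows "card {S \<in> fitting N w. Re (coeff_prod N w S) \<noteq> 0} =
    2 ^ (2 * ((card (odd_positions N w) - 1) div 2) + 1)"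
proof -
  have "{Y. Y \<subseteq> odd_positions N w \<and> Re (coeff_prod N w (fitting_set N w Y)) \<noteq> 0} =
      {Y. Y \<subseteq> odd_positions N w \<and> Re (signed_prod {p. w p = 3} (odd_positions N w) Y) \<noteq> 0}"
    using assms by (auto simp: coeff_prod_fitting_set)
  then show ?thesis
    unfolding card_fitting_filter using assms by (simp add: card_signed_prod_nonzero)
qed

lemma card_filter_eq_sum: "finite A \<Longrightarrow> card {x \<in> A. P x} = (\<Sum>x\<in>A. of_bool (P x))"
  by (simp add: of_bool_def flip: sum.inter_filter)

text \<open>Positions j + 1 are grouped by the pair (u_j, v_j), which determines the letter; the
  first two summands come from positions 0 and 1 with letters \<open>s\<close> and
  \<open>t\<close>.\<close>

lemma card_dual_positions:
  assumes "u \<in> {1..n} \<rightarrow> {0..3}" "v \<in> {1..n} \<rightarrow> {0..3}"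
  shows "card {p. p < n + 2 \<and> P (dual_word u v s t p)} = of_bool (P s) + of_bool (P t) +
    (\<Sum>k<4. \<Sum>l<4. of_bool (P (3 * (s * k + t * l) mod 4)) * freq n u v k l)"
proof -
  have "card {p. p < n + 2 \<and> P (dual_word u v s t p)} = (\<Sum>p<n + 2. of_bool (P (dual_word u v s t p)))"
    using card_filter_eq_sum[of "{..<n + 2}"] by simp
  also have "\<dots> = of_bool (P s) + of_bool (P t) + (\<Sum>j=1..n. of_bool (P (3 * (s * u j + t * v j) mod 4)))"
    by (simp add: sum.lessThan_Suc_shift sum.atLeast1_atMost_eq dual_word_def del: sum.lessThan_Suc)
  also have "(\<Sum>j=1..n. of_bool (P (3 * (s * u j + t * v j) mod 4)) :: nat) =
      (\<Sum>j=1..n. \<Sum>k<4. \<Sum>l<4. of_bool (P (3 * (s * k + t * l) mod 4)) * of_bool (u j = k \<and> v j = l))"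
  proof (intro sum.cong refl)
    fix j assume "j \<in> {1..n}"
    then have "u j < 4" "v j < 4"
      using assms by (force simp: Pi_iff)+
    then show "of_bool (P (3 * (s * u j + t * v j) mod 4)) =
      (\<Sum>k<4. \<Sum>l<4. of_bool (P (3 * (s * k + t * l) mod 4)) * (of_bool (u j = k \<and> v j = l)::nat))"
      by (auto dest!: less_4_cases simp: lessThan_4)
  qed
  also have "\<dots> = (\<Sum>k<4. \<Sum>j=1..n. \<Sum>l<4. of_bool (P (3 * (s * k + t * l) mod 4)) * of_bool (u j = k \<and> v j = l))"
    by (rule sum.swap)
  also have "\<dots> = (\<Sum>k<4. \<Sum>l<4. \<Sum>j=1..n. of_bool (P (3 * (s * k + t * l) mod 4)) * of_bool (u j = k \<and> v j = l))"
    by (intro sum.cong refl sum.swap)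
  also have "\<dots> = (\<Sum>k<4. \<Sum>l<4. of_bool (P (3 * (s * k + t * l) mod 4)) * freq n u v k l)"
    unfolding freq_def card_filter_eq_sum[OF finite_atLeastAtMost] sum_distrib_left ..
  finally show ?thesis .
qed

lemma two_powi_minus_floor_half: "2 powi (- \<lfloor>real m / 2\<rfloor>) = (1 / 2 :: real) ^ (m div 2)"
proof -
  have "\<lfloor>real m / 2\<rfloor> = int (m div 2)"
    using floor_divide_of_nat_eq[of m 2, where 'a = real] by simp
  then show ?thesis
    by (simp add: power_int_minus power_one_over inverse_eq_divide)
qed

lemma signed_prod_Un:
  assumes "finite X" "finite X'" "X \<inter> X' = {}"
  shows "signed_prod B (X \<union> X') Y = signed_prod B X (Y \<inter> X) * signed_prod B X' (Y \<inter> X')"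
  using assms unfolding signed_prod_def
  by (subst prod.union_disjoint) (auto intro!: arg_cong2[where f = "(*)"] prod.cong)

lemma signed_prod_cong:
  assumes "\<And>p. p \<in> X \<Longrightarrow> p \<in> B \<longleftrightarrow> p \<in> B'"
  shows "signed_prod B X Y = signed_prod B' X Y"
  using assms unfolding signed_prod_def by (intro prod.cong) auto

text \<open>Complementing the sign set within \<open>X\<close> replaces every factor by its
  conjugate.\<close>

lemma signed_prod_flip:
  assumes "\<And>p. p \<in> X \<Longrightarrow> p \<in> B \<longleftrightarrow> p \<notin> B'"
  shows "signed_prod B X Y = cnj (signed_prod B' X Y)"
  using assms unfolding signed_prod_def cnj_prod by (intro prod.cong) auto

section \<open>Classification of the words\<close>

context
  fixes n :: nat and u v :: "nat \<Rightarrow> nat"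
  assumes u: "u \<in> {1..n} \<rightarrow> {0..3}" and v: "v \<in> {1..n} \<rightarrow> {0..3}"
begin

abbreviation "dw \<equiv> dual_word u v"
definition fit :: "nat \<Rightarrow> nat \<Rightarrow> nat set set" where
  "fit s t = fitting (n + 2) (dw s t)"

definition dual_coeff :: "nat \<Rightarrow> nat \<Rightarrow> nat set \<Rightarrow> complex" where
  "dual_coeff s t = coeff_prod (n + 2) (dw s t)"

definition charsum :: "nat set \<Rightarrow> complex" where
  "charsum S = (\<Sum>s<4. \<Sum>t<4. dual_coeff s t S)"

text \<open>Membership tests the whole aliasing index, not the coefficient of one dual word, because
  a set can fit both (1,1) and (1,3).\<close>

definition class_words :: "nat \<Rightarrow> nat \<Rightarrow> nat set set" where
  "class_words s t = {S \<in> fit s t. aliasing_index n u v S \<noteq> 0}"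

lemma fit_subset: "S \<in> fit s t \<Longrightarrow> S \<subseteq> {0..<2 * n + 4}"
  by (auto simp: fit_def fitting_def)

lemma aliasing_index_charsum: "S \<subseteq> {0..<2 * n + 4} \<Longrightarrow> aliasing_index n u v S = cmod (charsum S)"
  by (simp add: aliasing_index_eq charsum_def dual_coeff_def)

lemma dual_word_less: "s < 4 \<Longrightarrow> t < 4 \<Longrightarrow> dw s t p < 4"
  by (simp add: dual_word_def)

lemma dual_word_neg: "s < 4 \<Longrightarrow> t < 4 \<Longrightarrow> dw (3 * s mod 4) (3 * t mod 4) p = 3 * dw s t p mod 4"
proof -
  have "((3 * s mod 4) * a + (3 * t mod 4) * b) mod 4 = (3 * (s * a + t * b)) mod 4" for a b
    unfolding distrib_left mult.assoc[symmetric] by (intro mod_add_cong) (simp_all only: mod_mult_left_eq)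
  then have "3 * ((3 * s mod 4) * a + (3 * t mod 4) * b) mod 4 = 3 * (3 * (s * a + t * b) mod 4) mod 4" for a b
    by (intro mod_mult_cong refl) simp
  then show ?thesis
    by (simp add: dual_word_def)
qed

text \<open>Used to compare (1,1) and (1,3) letter by letter: as 3 stands for -1, they are the sum
  and the difference of the generators (1,0) and (0,1).\<close>

lemma dual_word_linear:
  "dw 1 1 p = (dw 1 0 p + dw 0 1 p) mod 4" "dw 1 3 p = (dw 1 0 p + 3 * dw 0 1 p) mod 4"
proof -
  have "(3 * a + 3 * (3 * b)) mod 4 = (3 * a mod 4 + 3 * (3 * b mod 4)) mod 4" for a b :: nat
    by (intro mod_add_cong mod_mult_cong refl) simp_all
  then show "dw 1 3 p = (dw 1 0 p + 3 * dw 0 1 p) mod 4"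
    by (simp add: dual_word_def distrib_left del: mod_add_left_eq mod_add_right_eq)
qed (simp add: dual_word_def mod_simps)

text \<open>Columns 0 and 1 form position 0 with letter \<open>s\<close>, columns 2 and 3 form
  position 1 with letter \<open>t\<close>.\<close>

lemma fit_iff_01:
  assumes "S \<in> fit s t"
  shows "0 \<in> S \<and> 1 \<in> S \<longleftrightarrow> s = 2" "(0 \<in> S) \<noteq> (1 \<in> S) \<longleftrightarrow> odd s"
    and "2 \<in> S \<and> 3 \<in> S \<longleftrightarrow> t = 2" "(2 \<in> S) \<noteq> (3 \<in> S) \<longleftrightarrow> odd t"
proof -
  have "\<forall>p<n + 2. (2 * p \<in> S \<and> 2 * p + 1 \<in> S \<longleftrightarrow> dw s t p = 2) \<and> ((2 * p \<in> S) \<noteq> (2 * p + 1 \<in> S) \<longleftrightarrow> odd (dw s t p))"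
    using assms by (simp add: fit_def fitting_def)
  from this[rule_format, of 0] this[rule_format, of 1]
  show "0 \<in> S \<and> 1 \<in> S \<longleftrightarrow> s = 2" "(0 \<in> S) \<noteq> (1 \<in> S) \<longleftrightarrow> odd s"
    "2 \<in> S \<and> 3 \<in> S \<longleftrightarrow> t = 2" "(2 \<in> S) \<noteq> (3 \<in> S) \<longleftrightarrow> odd t"
    by (auto simp: dual_word_def numeral_eq_Suc)
qed

lemma fit_unique:
  assumes "S \<in> fit s t" "S \<in> fit s' t'"
  shows "odd s = odd s'" "s = 2 \<longleftrightarrow> s' = 2" "odd t = odd t'" "t = 2 \<longleftrightarrow> t' = 2"
  using fit_iff_01[OF assms(1)] fit_iff_01[OF assms(2)] by blast+

text \<open>For letters below 4 the hypothesis says that the pairs stay distinct under independent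
  sign changes of both letters. It does not separate (1,1) from (1,3).\<close>

lemma fit_disjoint:
  assumes "odd s \<noteq> odd s' \<or> (s = 2) \<noteq> (s' = 2) \<or> odd t \<noteq> odd t' \<or> (t = 2) \<noteq> (t' = 2)"
  shows "fit s t \<inter> fit s' t' = {}"
proof -
  have False if "S \<in> fit s t" "S \<in> fit s' t'" for S
    using assms fit_unique[OF that] by simp
  then show ?thesis
    by auto
qed

lemma class_words_disjoint:
  assumes "odd s \<noteq> odd s' \<or> (s = 2) \<noteq> (s' = 2) \<or> odd t \<noteq> odd t' \<or> (t = 2) \<noteq> (t' = 2)"
  shows "class_words s t \<inter> class_words s' t' = {}"
  using fit_disjoint[OF assms] by (auto simp: class_words_def)

lemma dual_coeff_not_fit:
  assumes "S \<subseteq> {0..<2 * n + 4}" "S \<notin> fit s t"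
  shows "dual_coeff s t S = 0"
proof -
  have "S \<subseteq> {0..<2 * (n + 2)}"
    using assms(1) by auto
  with assms(2) show ?thesis
    unfolding dual_coeff_def fit_def by (intro coeff_prod_not_fitting)
qed

lemma dual_coeff_zero:
  assumes "S \<in> fit s t"
    and "odd s \<noteq> odd s' \<or> (s = 2) \<noteq> (s' = 2) \<or> odd t \<noteq> odd t' \<or> (t = 2) \<noteq> (t' = 2)"
  shows "dual_coeff s' t' S = 0"
  using assms(1) fit_disjoint[OF assms(2)] fit_subset[OF assms(1)] by (intro dual_coeff_not_fit) auto

lemma dual_coeff_neg:
  assumes "s < 4" "t < 4"
  shows "dual_coeff (3 * s mod 4) (3 * t mod 4) S = cnj (dual_coeff s t S)"
  using assms unfolding dual_coeff_def by (intro coeff_prod_neg) (simp_all add: dual_word_less dual_word_neg)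

text \<open>Fitting only asks which letters are 2 and which are odd, and negation changes
  neither.\<close>

lemma fit_neg:
  assumes "s < 4" "t < 4"
  shows "fit (3 * s mod 4) (3 * t mod 4) = fit s t"
proof -
  have "(3 * k mod 4 = 2 \<longleftrightarrow> k = 2) \<and> (odd (3 * k mod 4) \<longleftrightarrow> odd k)" if "k < 4" for k :: nat
    using less_4_cases[OF that] by auto
  from this[OF dual_word_less[OF assms]] show ?thesis
    unfolding fit_def fitting_def dual_word_neg[OF assms] by blast
qed

lemmas dual_coeff_neg_simps =
  dual_coeff_neg[of 1 0, simplified] dual_coeff_neg[of 1 2, simplified]
  dual_coeff_neg[of 0 1, simplified] dual_coeff_neg[of 2 1, simplified]
  dual_coeff_neg[of 1 1, simplified] dual_coeff_neg[of 1 3, simplified]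

text \<open>Among the sixteen dual words only (s,t) and its negative can contribute, and their
  coefficients are conjugate.\<close>

lemma charsum_pair:
  assumes "S \<in> fit s t" "(s, t) \<in> {(1, 0), (1, 2), (0, 1), (2, 1)}"
  shows "charsum S = of_real (2 * Re (dual_coeff s t S))"
  using assms(2)
  by (elim insertE emptyE Pair_inject; hypsubst; simp add: charsum_def lessThan_4 dual_coeff_zero[OF assms(1)]
      dual_coeff_neg_simps complex_add_cnj)

text \<open>Four words may contribute here, since the signs of the two odd letters are independent:
  (1,1), (1,3) and their negatives.\<close>

lemma charsum_quadruple:
  assumes "S \<in> fit s t" "(s, t) \<in> {(1, 1), (1, 3)}"
  shows "charsum S = of_real (2 * Re (dual_coeff 1 1 S) + 2 * Re (dual_coeff 1 3 S))"
  using assms(2)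
  by (elim insertE emptyE Pair_inject; hypsubst; simp add: charsum_def lessThan_4 dual_coeff_zero[OF assms(1)]
      dual_coeff_neg_simps complex_eq_iff)

lemma charsum_single:
  assumes "S \<in> fit s t" "(s, t) \<in> {(2, 0), (0, 2), (2, 2)}"
  shows "charsum S = dual_coeff s t S"
  using assms(2)
  by (elim insertE emptyE Pair_inject; hypsubst; simp add: charsum_def lessThan_4 dual_coeff_zero[OF assms(1)])

section \<open>Letter counts of the dual words\<close>

abbreviation "odds s t \<equiv> card (odd_positions (n + 2) (dw s t))"
abbreviation "twos s t \<equiv> card {p. p < n + 2 \<and> dw s t p = 2}"

text \<open>The constants 1 and 2 count the odd letters among \<open>s\<close> and \<open>t\<close>
  themselves.\<close>

lemma odds_eq:
  "odds 1 0 = lam\<^sub>1 n u v + lam\<^sub>3 n u v + lam\<^sub>5 n u v + lam\<^sub>6 n u v + 1"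
  "odds 1 2 = lam\<^sub>1 n u v + lam\<^sub>3 n u v + lam\<^sub>5 n u v + lam\<^sub>6 n u v + 1"
  "odds 0 1 = lam\<^sub>2 n u v + lam\<^sub>4 n u v + lam\<^sub>5 n u v + lam\<^sub>6 n u v + 1"
  "odds 2 1 = lam\<^sub>2 n u v + lam\<^sub>4 n u v + lam\<^sub>5 n u v + lam\<^sub>6 n u v + 1"
  "odds 1 1 = lam\<^sub>1 n u v + lam\<^sub>2 n u v + lam\<^sub>3 n u v + lam\<^sub>4 n u v + 2"
  "odds 1 3 = lam\<^sub>1 n u v + lam\<^sub>2 n u v + lam\<^sub>3 n u v + lam\<^sub>4 n u v + 2"
  unfolding odd_positions_def card_dual_positions[OF u v, of odd] lessThan_4
    lam\<^sub>1_def lam\<^sub>2_def lam\<^sub>3_def lam\<^sub>4_def lam\<^sub>5_def lam\<^sub>6_def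
  by simp_all

lemma twos_eq:
  "twos 1 0 = lam\<^sub>4 n u v + lam\<^sub>8 n u v + lam\<^sub>9 n u v"
  "twos 1 2 = lam\<^sub>2 n u v + lam\<^sub>8 n u v + lam\<^sub>9 n u v + 1"
  "twos 0 1 = lam\<^sub>3 n u v + lam\<^sub>7 n u v + lam\<^sub>9 n u v"
  "twos 2 1 = lam\<^sub>1 n u v + lam\<^sub>7 n u v + lam\<^sub>9 n u v + 1"
  "twos 1 1 = lam\<^sub>5 n u v + lam\<^sub>7 n u v + lam\<^sub>8 n u v"
  "twos 1 3 = lam\<^sub>6 n u v + lam\<^sub>7 n u v + lam\<^sub>8 n u v"
  "twos 2 0 = lam\<^sub>1 n u v + lam\<^sub>3 n u v + lam\<^sub>5 n u v + lam\<^sub>6 n u v + 1"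
  "twos 0 2 = lam\<^sub>2 n u v + lam\<^sub>4 n u v + lam\<^sub>5 n u v + lam\<^sub>6 n u v + 1"
  "twos 2 2 = lam\<^sub>1 n u v + lam\<^sub>2 n u v + lam\<^sub>3 n u v + lam\<^sub>4 n u v + 2"
  unfolding card_dual_positions[OF u v, of "\<lambda>x. x = 2"] lessThan_4
    lam\<^sub>1_def lam\<^sub>2_def lam\<^sub>3_def lam\<^sub>4_def lam\<^sub>5_def lam\<^sub>6_def lam\<^sub>7_def lam\<^sub>8_def lam\<^sub>9_def
  by simp_all

lemma card_fit: "S \<in> fit s t \<Longrightarrow> card S = odds s t + 2 * twos s t"
  unfolding fit_def by (rule card_fitting)

lemma card_class_words_member: "S \<in> class_words s t \<Longrightarrow> card S = odds s t + 2 * twos s t"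
  unfolding class_words_def by (elim CollectE conjE) (rule card_fit)

lemma finite_class_words: "finite (class_words s t)"
  by (simp add: class_words_def fit_def)

lemma odd_positions_nonempty: "odd s \<or> odd t \<Longrightarrow> odd_positions (n + 2) (dw s t) \<noteq> {}"
proof -
  assume "odd s \<or> odd t"
  then have "0 \<in> odd_positions (n + 2) (dw s t) \<or> 1 \<in> odd_positions (n + 2) (dw s t)"
    by (auto simp: odd_positions_def dual_word_def)
  then show ?thesis
    by blast
qed

text \<open>The assumption \<open>index\<close> says that only this dual word and its negative
  contribute. It holds in (a) and (b), and for (1,1) and (1,3) once their fitting sets are
  disjoint.\<close>

lemma class_words_pair:
  assumes "s < 4" "t < 4" "odd s \<or> odd t"
    and index: "\<And>S. S \<in> fit s t \<Longrightarrow> aliasing_index n u v S = \<bar>2 * Re (dual_coeff s t S)\<bar>"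
  shows "card (class_words s t) = 2 ^ (2 * ((odds s t - 1) div 2) + 1)"
    and "S \<in> class_words s t \<Longrightarrow> aliasing_index n u v S = (1 / 2) ^ ((odds s t - 1) div 2)"
proof -
  note less = dual_word_less[OF assms(1,2)] and ne = odd_positions_nonempty[OF assms(3)]
  have "class_words s t = {S \<in> fit s t. Re (dual_coeff s t S) \<noteq> 0}"
    using index by (auto simp: class_words_def)
  then show "card (class_words s t) = 2 ^ (2 * ((odds s t - 1) div 2) + 1)"
    using card_fitting_nonzero[OF less ne] by (simp only: fit_def dual_coeff_def)
  assume S: "S \<in> class_words s t"
  then have "S \<in> fit s t" "Re (dual_coeff s t S) \<noteq> 0"
    using index[of S] by (auto simp: class_words_def)
  with abs_Re_coeff_prod[OF less ne] index[of S]
  show "aliasing_index n u v S = (1 / 2) ^ ((odds s t - 1) div 2)"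
    by (simp only: fit_def dual_coeff_def)
qed

lemma aliasing_index_pair:
  assumes "S \<in> fit s t" "(s, t) \<in> {(1, 0), (1, 2), (0, 1), (2, 1)}"
  shows "aliasing_index n u v S = \<bar>2 * Re (dual_coeff s t S)\<bar>"
  by (simp only: aliasing_index_charsum[OF fit_subset[OF assms(1)]] charsum_pair[OF assms] norm_of_real)

lemma odd_positions_empty:
  assumes "(s, t) \<in> {(2, 0), (0, 2), (2, 2)}"
  shows "odd_positions (n + 2) (dw s t) = {}"
  using assms by (auto simp: odd_positions_def dual_word_def dvd_mod_iff)

text \<open>With no odd position the only choice is the empty \<open>Y\<close>, and its coefficient
  is an empty product.\<close>

lemma class_words_single:
  assumes "(s, t) \<in> {(2, 0), (0, 2), (2, 2)}"
  obtains S where "class_words s t = {S}" "aliasing_index n u v S = 1"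
proof -
  have less: "s < 4" "t < 4"
    using assms by auto
  note no_odd = odd_positions_empty[OF assms]
  have fit_eq: "fit s t = {fitting_set (n + 2) (dw s t) {}}"
    unfolding fit_def
    using bij_betw_imp_surj_on[OF bij_betw_fitting_set[of "n + 2" "dw s t"],
        unfolded no_odd Pow_empty image_insert image_empty]
    by (rule sym)
  let ?S = "fitting_set (n + 2) (dw s t) {}"
  have "?S \<in> fit s t"
    by (simp add: fit_eq)
  moreover have "dual_coeff s t ?S = 1"
    using less unfolding dual_coeff_def
    by (subst coeff_prod_fitting_set) (simp_all only: dual_word_less no_odd, simp_all add: signed_prod_def)
  ultimately have index: "aliasing_index n u v ?S = 1"
    by (simp only: aliasing_index_charsum[OF fit_subset] charsum_single[OF _ assms] norm_one)
  then have "class_words s t = {?S}"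
    by (auto simp: class_words_def fit_eq)
  with index show thesis
    using that by blast
qed

lemma dual_coeff_fitting_set:
  assumes "s < 4" "t < 4" "Y \<subseteq> odd_positions (n + 2) (dw s t)"
  shows "dual_coeff s t (fitting_set (n + 2) (dw s t) Y) =
    signed_prod {p. dw s t p = 3} (odd_positions (n + 2) (dw s t)) Y"
  using assms unfolding dual_coeff_def by (intro coeff_prod_fitting_set dual_word_less)

text \<open>Up to sign there are nine nonzero pairs (s,t). A nonzero character sum has a nonzero
  term, whose pair is moved to one of these nine by \<open>fit_neg\<close>.\<close>

lemma words_decomposition:
  "words n u v = (class_words 1 0 \<union> class_words 1 2) \<union> (class_words 0 1 \<union> class_words 2 1) \<union>
    (class_words 2 0 \<union> class_words 0 2 \<union> class_words 2 2) \<union> (class_words 1 1 \<union> class_words 1 3)"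
    (is "_ = ?R")
proof
  show "?R \<subseteq> words n u v"
  proof
    fix S assume "S \<in> ?R"
    then obtain s t where st: "S \<in> class_words s t"
      "(s, t) \<in> {(1, 0), (1, 2), (0, 1), (2, 1), (2, 0), (0, 2), (2, 2), (1, 1), (1, 3)}"
      by auto
    then have "S \<in> fit s t"
      by (simp add: class_words_def)
    moreover from fit_iff_01[OF this] have "S \<noteq> {}"
      using st(2) by auto
    ultimately show "S \<in> words n u v"
      using st fit_subset by (auto simp: words_def class_words_def)
  qed
next
  show "words n u v \<subseteq> ?R"
  proof
    fix S assume "S \<in> words n u v"
    then have S: "S \<subseteq> {0..<2 * n + 4}" "S \<noteq> {}" "aliasing_index n u v S \<noteq> 0"
      by (auto simp: words_def)
    then have "charsum S \<noteq> 0"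
      by (simp add: aliasing_index_charsum)
    then obtain s t where less: "s < 4" "t < 4" and nz: "dual_coeff s t S \<noteq> 0"
      unfolding charsum_def by (metis (no_types, lifting) lessThan_iff sum.neutral)
    then have fit: "S \<in> fit s t"
      using S(1) dual_coeff_not_fit by blast
    \<comment> \<open>The zero word fits only the empty set.\<close>
    have "(s, t) \<noteq> (0, 0)"
    proof
      assume "(s, t) = (0, 0)"
      then have "card S = 0"
        using card_fit[OF fit] by (simp add: odd_positions_def dual_word_def)
      then show False
        using S(2) finite_subset[OF S(1)] by simp
    qed
    moreover note fit_neg[of 1 0] fit_neg[of 1 2] fit_neg[of 0 1] fit_neg[of 2 1] fit_neg[of 1 1] fit_neg[of 1 3]
    ultimately show "S \<in> ?R"
      using fit S(3) less_4_cases[OF less(1)] less_4_cases[OF less(2)]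
      by (auto simp: class_words_def)
  qed
qed

section \<open>Positions where both u and v are odd\<close>

lemma freq_pos: "j \<in> {1..n} \<Longrightarrow> freq n u v (u j) (v j) > 0"
  by (auto simp: freq_def card_gt_0_iff)

text \<open>\<open>lam\<^sub>5 + lam\<^sub>6\<close> counts the indices j with u_j and v_j both odd,
  and at each of the positions 0 and 1 one of the two words has letter 0.\<close>

lemma no_common_odd_position:
  assumes "lam\<^sub>5 n u v + lam\<^sub>6 n u v = 0" "p < n + 2"
  shows "even (dw 1 0 p) \<or> even (dw 0 1 p)"
proof (rule ccontr)
  assume odd: "\<not> ?thesis"
  then have "p \<noteq> 0" "p \<noteq> 1" and "odd (u (p - 1))" "odd (v (p - 1))"
    by (auto simp: dual_word_def dvd_mod_iff split: if_splits)
  moreover from this have j: "p - 1 \<in> {1..n}"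
    using assms(2) by auto
  moreover have "u (p - 1) < 4" "v (p - 1) < 4"
    using j u v by (force simp: Pi_iff)+
  ultimately show False
    using freq_pos[OF j] assms(1) less_4_cases[of "u (p - 1)"] less_4_cases[of "v (p - 1)"]
    by (auto simp: lam\<^sub>5_def lam\<^sub>6_def)
qed

lemma common_odd_position:
  assumes "lam\<^sub>5 n u v + lam\<^sub>6 n u v > 0"
  obtains p where "p < n + 2" "odd (dw 1 0 p)" "odd (dw 0 1 p)"
proof -
  have "freq n u v 1 1 > 0 \<or> freq n u v 3 3 > 0 \<or> freq n u v 1 3 > 0 \<or> freq n u v 3 1 > 0"
    using assms by (auto simp: lam\<^sub>5_def lam\<^sub>6_def)
  then obtain j where "j \<in> {1..n}" "odd (u j)" "odd (v j)"
    by (auto simp: freq_def card_gt_0_iff)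
  then show thesis
    by (intro that[of "j + 1"]) (auto simp: dual_word_def dvd_mod_iff)
qed

text \<open>For odd letters x and y, x + y and x - y are even and differ by 2 modulo 4. So at a
  common odd position one word demands both columns and the other neither.\<close>

lemma fit_11_13_disjoint:
  assumes "lam\<^sub>5 n u v + lam\<^sub>6 n u v > 0"
  shows "fit 1 1 \<inter> fit 1 3 = {}"
proof -
  obtain p where p: "p < n + 2" "odd (dw 1 0 p)" "odd (dw 0 1 p)"
    using common_odd_position[OF assms] .
  have sums: "(x + y) mod 4 = 2 \<longleftrightarrow> (x + 3 * y) mod 4 \<noteq> 2" if "odd x" "odd y" "x < 4" "y < 4" for x y :: nat
    using that(1,2) less_4_cases[OF that(3)] less_4_cases[OF that(4)] by auto
  have "dw 1 1 p = 2 \<longleftrightarrow> dw 1 3 p \<noteq> 2"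
    unfolding dual_word_linear by (rule sums[OF p(2,3) dual_word_less dual_word_less]) simp_all
  with p(1) show ?thesis
    unfolding fit_def fitting_def by blast
qed

lemma aliasing_index_quadruple:
  assumes "S \<in> fit s t" "(s, t) \<in> {(1, 1), (1, 3)}"
  shows "aliasing_index n u v S = \<bar>2 * Re (dual_coeff 1 1 S) + 2 * Re (dual_coeff 1 3 S)\<bar>"
  by (simp only: aliasing_index_charsum[OF fit_subset[OF assms(1)]] charsum_quadruple[OF assms] norm_of_real)

lemma aliasing_index_11_13:
  assumes "lam\<^sub>5 n u v + lam\<^sub>6 n u v > 0" "S \<in> fit s t" "(s, t) \<in> {(1, 1), (1, 3)}"
  shows "aliasing_index n u v S = \<bar>2 * Re (dual_coeff s t S)\<bar>"
proof -
  have "(s, t) = (1, 1) \<and> S \<notin> fit 1 3 \<or> (s, t) = (1, 3) \<and> S \<notin> fit 1 1"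
    using assms(2,3) fit_11_13_disjoint[OF assms(1)] by auto
  then show ?thesis
    using aliasing_index_quadruple[OF assms(2,3)] dual_coeff_not_fit[OF fit_subset[OF assms(2)]]
    by auto
qed

text \<open>If y is even, x - y equals x + y modulo 4; if x is even, it equals -(x + y). Hence the
  letters of (1,3) and (1,1) agree where x is odd and are opposite where y is odd.\<close>

lemma mod_4_even_cases:
  fixes x y :: nat
  assumes "x < 4" "y < 4" "even x \<or> even y"
  shows "odd ((x + y) mod 4) \<longleftrightarrow> odd x \<or> odd y" "odd ((x + 3 * y) mod 4) \<longleftrightarrow> odd x \<or> odd y"
    and "(x + y) mod 4 = 2 \<longleftrightarrow> (x + 3 * y) mod 4 = 2"
    and "odd x \<Longrightarrow> (x + 3 * y) mod 4 = 3 \<longleftrightarrow> (x + y) mod 4 = 3"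
    and "odd y \<Longrightarrow> (x + 3 * y) mod 4 = 3 \<longleftrightarrow> (x + y) mod 4 \<noteq> 3"
  using assms(3) less_4_cases[OF assms(1)] less_4_cases[OF assms(2)] by auto

section \<open>The case without common odd positions\<close>

context
  assumes lam56: "lam\<^sub>5 n u v + lam\<^sub>6 n u v = 0"
begin

abbreviation "odd_u \<equiv> odd_positions (n + 2) (dw 1 0)"
abbreviation "odd_v \<equiv> odd_positions (n + 2) (dw 0 1)"

lemma odd_positions_disjoint: "odd_u \<inter> odd_v = {}"
  using no_common_odd_position[OF lam56] by (auto simp: odd_positions_def)

lemmas dual_word_even_cases =
  mod_4_even_cases[OF dual_word_less dual_word_less no_common_odd_position[OF lam56],
    folded dual_word_linear, simplified]

lemma odd_positions_11_13:
  "odd_positions (n + 2) (dw 1 1) = odd_u \<union> odd_v" "odd_positions (n + 2) (dw 1 3) = odd_u \<union> odd_v"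
  using dual_word_even_cases(1,2) by (auto simp: odd_positions_def)

lemma fitting_set_11_13: "fitting_set (n + 2) (dw 1 3) Y = fitting_set (n + 2) (dw 1 1) Y"
proof -
  have "dw 1 3 p = 2 \<longleftrightarrow> dw 1 1 p = 2" "odd (dw 1 3 p) \<longleftrightarrow> odd (dw 1 1 p)" if "p < n + 2" for p
    using dual_word_even_cases[of p] that by auto
  then show ?thesis
    unfolding fitting_set_def by (intro Collect_cong conj_cong refl) auto
qed

lemma fit_11_13: "fit 1 3 = fit 1 1"
  using bij_betw_imp_surj_on[OF bij_betw_fitting_set[of "n + 2" "dw 1 1"]]
    bij_betw_imp_surj_on[OF bij_betw_fitting_set[of "n + 2" "dw 1 3"]]
  unfolding fit_def odd_positions_11_13 fitting_set_11_13 by simp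

abbreviation "signs \<equiv> {p. dw 1 1 p = 3}"

text \<open>With a and b the products over \<open>odd_u\<close> and \<open>odd_v\<close>, the words
  (1,1) and (1,3) contribute ab and a conj(b), and Re(ab) + Re(a conj(b)) = 2 Re(a) Re(b).\<close>

lemma aliasing_index_fitting_set:
  assumes "Y \<subseteq> odd_u \<union> odd_v"
  shows "aliasing_index n u v (fitting_set (n + 2) (dw 1 1) Y) =
    \<bar>2 * Re (signed_prod signs odd_u (Y \<inter> odd_u))\<bar> * \<bar>2 * Re (signed_prod signs odd_v (Y \<inter> odd_v))\<bar>"
proof -
  let ?S = "fitting_set (n + 2) (dw 1 1) Y" and ?a = "signed_prod signs odd_u (Y \<inter> odd_u)"
    and ?b = "signed_prod signs odd_v (Y \<inter> odd_v)"
  note Un = signed_prod_Un[OF finite_odd_positions finite_odd_positions odd_positions_disjoint]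
  have "?S \<in> fit 1 1"
    unfolding fit_def bij_betw_imp_surj_on[OF bij_betw_fitting_set, symmetric] odd_positions_11_13
    using assms by blast
  moreover have "dual_coeff 1 1 ?S = ?a * ?b"
    using dual_coeff_fitting_set[of 1 1 Y, unfolded odd_positions_11_13 Un, OF _ _ assms] by simp
  \<comment> \<open>The word (1,3) agrees with (1,1) on \<open>odd_u\<close> and is its negative on
    \<open>odd_v\<close>.\<close>
  moreover have "dual_coeff 1 3 ?S = ?a * cnj ?b"
  proof -
    have "dual_coeff 1 3 ?S = signed_prod {p. dw 1 3 p = 3} odd_u (Y \<inter> odd_u) * signed_prod {p. dw 1 3 p = 3} odd_v (Y \<inter> odd_v)"
      using dual_coeff_fitting_set[of 1 3 Y, unfolded odd_positions_11_13 fitting_set_11_13 Un, OF _ _ assms]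
      by simp
    also have "signed_prod {p. dw 1 3 p = 3} odd_u (Y \<inter> odd_u) = ?a"
      using dual_word_even_cases(4) by (intro signed_prod_cong) (auto simp: odd_positions_def)
    also have "signed_prod {p. dw 1 3 p = 3} odd_v (Y \<inter> odd_v) = cnj ?b"
      using dual_word_even_cases(5) by (intro signed_prod_flip) (auto simp: odd_positions_def)
    finally show ?thesis .
  qed
  ultimately have "aliasing_index n u v ?S = \<bar>2 * Re (?a * ?b) + 2 * Re (?a * cnj ?b)\<bar>"
    using aliasing_index_quadruple[of ?S 1 1] by simp
  also have "2 * Re (?a * ?b) + 2 * Re (?a * cnj ?b) = (2 * Re ?a) * (2 * Re ?b)"
    by simp
  finally show ?thesis
    by (simp only: abs_mult)
qed

text \<open>The index is a product of two real parts depending on disjoint sets of positions, so the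
  numbers of choices keeping each nonzero multiply.\<close>

lemma class_words_11:
  shows "card (class_words 1 1) = 2 ^ (2 * ((card odd_u - 1) div 2) + 1) * 2 ^ (2 * ((card odd_v - 1) div 2) + 1)"
    and "S \<in> class_words 1 1 \<Longrightarrow>
      aliasing_index n u v S = (1 / 2) ^ ((card odd_u - 1) div 2) * (1 / 2) ^ ((card odd_v - 1) div 2)"
proof -
  have ne: "odd_u \<noteq> {}" "odd_v \<noteq> {}"
    by (simp_all add: odd_positions_nonempty del: add_2_eq_Suc')
  have "card (class_words 1 1) = card {Y. Y \<subseteq> odd_u \<union> odd_v \<and>
      aliasing_index n u v (fitting_set (n + 2) (dw 1 1) Y) \<noteq> 0}"
    unfolding class_words_def fit_def card_fitting_filter odd_positions_11_13 ..
  also have "{Y. Y \<subseteq> odd_u \<union> odd_v \<and> aliasing_index n u v (fitting_set (n + 2) (dw 1 1) Y) \<noteq> 0} =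
      {Y. Y \<subseteq> odd_u \<union> odd_v \<and> Re (signed_prod signs odd_u (Y \<inter> odd_u)) \<noteq> 0 \<and> Re (signed_prod signs odd_v (Y \<inter> odd_v)) \<noteq> 0}"
    by (intro Collect_cong conj_cong refl) (simp only: aliasing_index_fitting_set, simp)
  finally show "card (class_words 1 1) =
      2 ^ (2 * ((card odd_u - 1) div 2) + 1) * 2 ^ (2 * ((card odd_v - 1) div 2) + 1)"
    by (simp only: card_subsets_disjoint_union[OF odd_positions_disjoint,
          of "\<lambda>Y. Re (signed_prod signs odd_u Y) \<noteq> 0" "\<lambda>Y. Re (signed_prod signs odd_v Y) \<noteq> 0"]
        card_signed_prod_nonzero[OF finite_odd_positions ne(1)]
        card_signed_prod_nonzero[OF finite_odd_positions ne(2)])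
  assume "S \<in> class_words 1 1"
  then obtain Y where Y: "Y \<subseteq> odd_u \<union> odd_v" "S = fitting_set (n + 2) (dw 1 1) Y"
    and nz: "aliasing_index n u v S \<noteq> 0"
    unfolding class_words_def fit_def bij_betw_imp_surj_on[OF bij_betw_fitting_set, symmetric] odd_positions_11_13
    by blast
  have "\<bar>2 * Re (signed_prod signs odd_u (Y \<inter> odd_u))\<bar> = (1 / 2) ^ ((card odd_u - 1) div 2)"
    "\<bar>2 * Re (signed_prod signs odd_v (Y \<inter> odd_v))\<bar> = (1 / 2) ^ ((card odd_v - 1) div 2)"
    using nz unfolding Y(2) aliasing_index_fitting_set[OF Y(1)]
      abs_Re_signed_prod[OF finite_odd_positions ne(1)] abs_Re_signed_prod[OF finite_odd_positions ne(2)]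
    by (simp_all only: split: if_splits) simp_all
  then show "aliasing_index n u v S = (1 / 2) ^ ((card odd_u - 1) div 2) * (1 / 2) ^ ((card odd_v - 1) div 2)"
    unfolding Y(2) aliasing_index_fitting_set[OF Y(1)] by (simp only:)
qed

end

section \<open>Sizes, indices and lengths of the four classes\<close>

lemma two_classes:
  assumes "s < 4" "t < 4" "odd s \<or> odd t" "s' < 4" "t' < 4" "odd s' \<or> odd t'"
    and "\<And>S. S \<in> fit s t \<Longrightarrow> aliasing_index n u v S = \<bar>2 * Re (dual_coeff s t S)\<bar>"
    and "\<And>S. S \<in> fit s' t' \<Longrightarrow> aliasing_index n u v S = \<bar>2 * Re (dual_coeff s' t' S)\<bar>"
    and disj: "class_words s t \<inter> class_words s' t' = {}"
    and m: "odds s t = Suc m" "odds s' t' = Suc m"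
    and r: "r = (1 / 2) ^ (m div 2)"
    and len: "p = Suc m + 2 * twos s t" "q = Suc m + 2 * twos s' t'"
  defines "W \<equiv> class_words s t \<union> class_words s' t'"
  shows "finite W \<and> real (card W) = 4 / r\<^sup>2 \<and> (\<forall>S\<in>W. aliasing_index n u v S = r) \<and>
    half_of_each_length W p q"
proof (intro conjI ballI)
  \<comment> \<open>Equal numbers \<open>Suc m\<close> of odd positions give both parts the same
    size; this makes them halves of \<open>W\<close>.\<close>
  note P = class_words_pair[OF assms(1-3,7), unfolded m diff_Suc_1]
    and Q = class_words_pair[OF assms(4-6,8), unfolded m diff_Suc_1]
  show "finite W"
    by (simp add: W_def finite_class_words)
  \<comment> \<open>With q = \<open>m div 2\<close> and r = 2^(-q) this number is 4 times 4^q, that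
    is 4 / r^2.\<close>
  have "card W = 2 * (2 ^ (2 * (m div 2) + 1))"
    unfolding W_def using P(1) Q(1) by (simp add: card_Un_disjoint finite_class_words disj)
  then show "real (card W) = 4 / r\<^sup>2"
    by (simp add: r power_one_over power_mult[symmetric] mult.commute)
  show "aliasing_index n u v S = r" if "S \<in> W" for S
    using that P(2) Q(2) by (auto simp: W_def r)
  show "half_of_each_length W p q"
    unfolding half_of_each_length_def W_def
    using P(1) Q(1) disj card_class_words_member m len
    by (intro exI[of _ "class_words s t"] exI[of _ "class_words s' t'"]) auto
qed

lemmas lengths =
  l\<^sub>1_def l\<^sub>2_def l\<^sub>3_def l\<^sub>4_def l\<^sub>5_def l\<^sub>6_def l\<^sub>7_def l\<^sub>8_def l\<^sub>9_def l\<^sub>1\<^sub>0_def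

text \<open>\<open>m\<close> leaves out the odd letter at position 0. The word (1,2) also has the
  letter 2 at position 1, whose two columns turn + 1 into + 3.\<close>

lemma class_a:
  defines "A \<equiv> class_words 1 0 \<union> class_words 1 2"
  shows "finite A \<and> real (card A) = 4 / (\<rho>\<^sub>1 n u v)\<^sup>2 \<and> (\<forall>S\<in>A. aliasing_index n u v S = \<rho>\<^sub>1 n u v) \<and>
    half_of_each_length A (l\<^sub>1 n u v + 1) (l\<^sub>3 n u v + 3)"
  unfolding A_def
  by (rule two_classes[where m = "lam\<^sub>1 n u v + lam\<^sub>3 n u v + lam\<^sub>5 n u v + lam\<^sub>6 n u v",
      OF _ _ _ _ _ _ aliasing_index_pair aliasing_index_pair class_words_disjoint])
    (simp_all only: odds_eq twos_eq, simp_all add: lengths \<rho>\<^sub>1_def two_powi_minus_floor_half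
      del: of_nat_add)

lemma class_b:
  defines "A \<equiv> class_words 0 1 \<union> class_words 2 1"
  shows "finite A \<and> real (card A) = 4 / (\<rho>\<^sub>2 n u v)\<^sup>2 \<and> (\<forall>S\<in>A. aliasing_index n u v S = \<rho>\<^sub>2 n u v) \<and>
    half_of_each_length A (l\<^sub>2 n u v + 1) (l\<^sub>4 n u v + 3)"
  unfolding A_def
  by (rule two_classes[where m = "lam\<^sub>2 n u v + lam\<^sub>4 n u v + lam\<^sub>5 n u v + lam\<^sub>6 n u v",
      OF _ _ _ _ _ _ aliasing_index_pair aliasing_index_pair class_words_disjoint])
    (simp_all only: odds_eq twos_eq, simp_all add: lengths \<rho>\<^sub>2_def two_powi_minus_floor_half
      del: of_nat_add)

text \<open>Each length is twice the number of letters 2; those at positions 0 and 1 account for the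
  added 2, 2 and 4.\<close>

lemma class_c:
  defines "A \<equiv> class_words 2 0 \<union> class_words 0 2 \<union> class_words 2 2"
  shows "\<exists>S\<^sub>1 S\<^sub>2 S\<^sub>3. A = {S\<^sub>1, S\<^sub>2, S\<^sub>3} \<and> S\<^sub>1 \<noteq> S\<^sub>2 \<and> S\<^sub>1 \<noteq> S\<^sub>3 \<and> S\<^sub>2 \<noteq> S\<^sub>3 \<and>
      (\<forall>S\<in>A. aliasing_index n u v S = 1) \<and>
      card S\<^sub>1 = l\<^sub>5 n u v + 2 \<and> card S\<^sub>2 = l\<^sub>6 n u v + 2 \<and> card S\<^sub>3 = l\<^sub>7 n u v + 4"
proof -
  have mem: "(2, 0) \<in> {(2, 0), (0, 2), (2, 2)}" "(0, 2) \<in> {(2, 0), (0, 2), (2, 2)}"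
    "(2, 2) \<in> {(2, 0), (0, 2), (2, 2)}"
    by simp_all
  obtain S\<^sub>1 S\<^sub>2 S\<^sub>3 where cls: "class_words 2 0 = {S\<^sub>1}" "class_words 0 2 = {S\<^sub>2}" "class_words 2 2 = {S\<^sub>3}"
    and index: "aliasing_index n u v S\<^sub>1 = 1" "aliasing_index n u v S\<^sub>2 = 1" "aliasing_index n u v S\<^sub>3 = 1"
    using class_words_single[OF mem(1)] class_words_single[OF mem(2)] class_words_single[OF mem(3)] by metis
  have "S\<^sub>1 \<noteq> S\<^sub>2" "S\<^sub>1 \<noteq> S\<^sub>3" "S\<^sub>2 \<noteq> S\<^sub>3"
    using class_words_disjoint[of 2 0 0 2] class_words_disjoint[of 2 2 0 2] class_words_disjoint[of 0 2 2 2]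
    by (simp_all add: cls)
  moreover have "card S = 2 * twos s t" if "class_words s t = {S}" "(s, t) \<in> {(2, 0), (0, 2), (2, 2)}" for S s t
    using card_class_words_member[of S s t] odd_positions_empty[OF that(2)] that(1) by simp
  from this[OF cls(1) mem(1)] this[OF cls(2) mem(2)] this[OF cls(3) mem(3)]
  have "card S\<^sub>1 = l\<^sub>5 n u v + 2" "card S\<^sub>2 = l\<^sub>6 n u v + 2" "card S\<^sub>3 = l\<^sub>7 n u v + 4"
    unfolding twos_eq lengths by simp_all
  moreover have "A = {S\<^sub>1, S\<^sub>2, S\<^sub>3}"
    unfolding A_def cls by blast
  ultimately show ?thesis
    using index by blast
qed

lemma class_d1:
  assumes lam56: "lam\<^sub>5 n u v + lam\<^sub>6 n u v = 0"
  defines "A \<equiv> class_words 1 1 \<union> class_words 1 3"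
  shows "finite A \<and> real (card A) = 4 / ((\<xi>\<^sub>1 n u v)\<^sup>2 * (\<xi>\<^sub>2 n u v)\<^sup>2) \<and>
    (\<forall>S\<in>A. aliasing_index n u v S = \<xi>\<^sub>1 n u v * \<xi>\<^sub>2 n u v \<and> card S = l\<^sub>8 n u v + 2)"
proof -
  \<comment> \<open>Both words have the same fitting sets here, so the union is a single
    class.\<close>
  have A: "A = class_words 1 1"
    unfolding A_def class_words_def fit_11_13[OF lam56] by simp
  have zero: "lam\<^sub>5 n u v = 0" "lam\<^sub>6 n u v = 0"
    using lam56 by simp_all
  have xi: "(1 / 2) ^ ((odds 1 0 - 1) div 2) = \<xi>\<^sub>1 n u v" "(1 / 2) ^ ((odds 0 1 - 1) div 2) = \<xi>\<^sub>2 n u v"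
    unfolding odds_eq \<xi>\<^sub>1_def \<xi>\<^sub>2_def two_powi_minus_floor_half zero by simp_all
  have "real (card A) = 4 / ((\<xi>\<^sub>1 n u v)\<^sup>2 * (\<xi>\<^sub>2 n u v)\<^sup>2)"
    unfolding A class_words_11(1)[OF lam56] xi[symmetric]
    by (simp add: power_one_over power_mult[symmetric] mult.commute)
  moreover have "aliasing_index n u v S = \<xi>\<^sub>1 n u v * \<xi>\<^sub>2 n u v" if "S \<in> A" for S
    using class_words_11(2)[OF lam56] that unfolding A xi by simp
  moreover have "card S = l\<^sub>8 n u v + 2" if "S \<in> A" for S
    using card_class_words_member[of S 1 1] that unfolding A odds_eq twos_eq lengths zero by simp
  ultimately show ?thesis
    unfolding A by (simp add: finite_class_words)
qed

lemma class_d2: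
  assumes lam56: "lam\<^sub>5 n u v + lam\<^sub>6 n u v > 0"
  defines "A \<equiv> class_words 1 1 \<union> class_words 1 3"
  shows "finite A \<and> real (card A) = 4 / (\<xi> n u v)\<^sup>2 \<and> (\<forall>S\<in>A. aliasing_index n u v S = \<xi> n u v) \<and>
    half_of_each_length A (l\<^sub>9 n u v + 2) (l\<^sub>1\<^sub>0 n u v + 2)"
proof -
  have "class_words 1 1 \<inter> class_words 1 3 = {}"
    using fit_11_13_disjoint[OF lam56] by (auto simp: class_words_def)
  then show ?thesis
    unfolding A_def
    \<comment> \<open>Of the odd letters at positions 0 and 1, one is absorbed by
      \<open>Suc m\<close>; the other is the + 1 here and in the exponent of
      \<open>\<xi>\<close>.\<close>
    by (intro two_classes[where m = "lam\<^sub>1 n u v + lam\<^sub>2 n u v + lam\<^sub>3 n u v + lam\<^sub>4 n u v + 1"]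
        aliasing_index_11_13[OF lam56])
      (simp_all only: odds_eq twos_eq, simp_all add: lengths \<xi>_def two_powi_minus_floor_half
        del: of_nat_add of_nat_Suc)
qed

end

theorem theorem2:
  fixes n :: nat and u v :: "nat \<Rightarrow> nat"
  assumes "n \<ge> 1"
    and "u \<in> {1..n} \<rightarrow> {0..3}"
    and "v \<in> {1..n} \<rightarrow> {0..3}"
  shows "\<exists>A B C E.
    words n u v = A \<union> B \<union> C \<union> E \<and>
    A \<inter> B = {} \<and> A \<inter> C = {} \<and> A \<inter> E = {} \<and> B \<inter> C = {} \<and> B \<inter> E = {} \<and> C \<inter> E = {} \<and>
    (finite A \<and> real (card A) = 4 / (\<rho>\<^sub>1 n u v)\<^sup>2 \<and>
      (\<forall>S\<in>A. aliasing_index n u v S = \<rho>\<^sub>1 n u v) \<and>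
      half_of_each_length A (l\<^sub>1 n u v + 1) (l\<^sub>3 n u v + 3)) \<and>
    (finite B \<and> real (card B) = 4 / (\<rho>\<^sub>2 n u v)\<^sup>2 \<and>
      (\<forall>S\<in>B. aliasing_index n u v S = \<rho>\<^sub>2 n u v) \<and>
      half_of_each_length B (l\<^sub>2 n u v + 1) (l\<^sub>4 n u v + 3)) \<and>
    (\<exists>S\<^sub>1 S\<^sub>2 S\<^sub>3. C = {S\<^sub>1, S\<^sub>2, S\<^sub>3} \<and> S\<^sub>1 \<noteq> S\<^sub>2 \<and> S\<^sub>1 \<noteq> S\<^sub>3 \<and> S\<^sub>2 \<noteq> S\<^sub>3 \<and>
      (\<forall>S\<in>C. aliasing_index n u v S = 1) \<and>
      card S\<^sub>1 = l\<^sub>5 n u v + 2 \<and> card S\<^sub>2 = l\<^sub>6 n u v + 2 \<and> card S\<^sub>3 = l\<^sub>7 n u v + 4) \<and>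
    (lam\<^sub>5 n u v + lam\<^sub>6 n u v = 0 \<longrightarrow>
      finite E \<and> real (card E) = 4 / ((\<xi>\<^sub>1 n u v)\<^sup>2 * (\<xi>\<^sub>2 n u v)\<^sup>2) \<and>
      (\<forall>S\<in>E. aliasing_index n u v S = \<xi>\<^sub>1 n u v * \<xi>\<^sub>2 n u v \<and> card S = l\<^sub>8 n u v + 2)) \<and>
    (lam\<^sub>5 n u v + lam\<^sub>6 n u v > 0 \<longrightarrow>
      finite E \<and> real (card E) = 4 / (\<xi> n u v)\<^sup>2 \<and>
      (\<forall>S\<in>E. aliasing_index n u v S = \<xi> n u v) \<and>
      half_of_each_length E (l\<^sub>9 n u v + 2) (l\<^sub>1\<^sub>0 n u v + 2))"
proof -
  note uv = assms(2,3)
  let ?W = "class_words n u v"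
  \<comment> \<open>The four unions are separated already by the letters at positions 0 and 1, taken
    up to sign.\<close>
  have disj: "?W s t \<inter> ?W s' t' = {}"
    if "odd s \<noteq> odd s' \<or> (s = 2) \<noteq> (s' = 2) \<or> odd t \<noteq> odd t' \<or> (t = 2) \<noteq> (t' = 2)" for s t s' t'
    by (rule class_words_disjoint[OF uv that])
  show ?thesis
    by (intro exI[of _ "?W 1 0 \<union> ?W 1 2"] exI[of _ "?W 0 1 \<union> ?W 2 1"]
        exI[of _ "?W 2 0 \<union> ?W 0 2 \<union> ?W 2 2"] exI[of _ "?W 1 1 \<union> ?W 1 3"] conjI impI
        words_decomposition[OF uv] class_a[OF uv] class_b[OF uv] class_c[OF uv]
        class_d1[OF uv] class_d2[OF uv])
      (simp_all only: Int_Un_distrib Int_Un_distrib2 Un_empty disj, simp_all add: disj)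
qed

end
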